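(* Let $1\le p<\infty$ and $\alpha\ge 0$. A bounded set $K\subset L^p_\alpha$ is precompact (totally bounded) in $L^p_\alpha$ if and only if both of the following properties hold. $(\mathbf{P_a})$ For every $\varepsilon>0$ there is an $R>0$ such that for all $f\in K$ $$\left(\int_R^\infty \left|f(x)e^{-\frac{x}{2}}\right|^p x^\alpha\,dx\right)^{\frac1p}<\varepsilon .$$ $(\mathbf{P_b})$ For every $\varepsilon>0$ and every $M_0>0$ there is a $\delta>0$ such that for all $0\le t\le M_0$, all $0\le h\le\delta$ and all $f\in K$ $$\left(\int_0^\infty \left|\left(T^\alpha_{t+h}f(x)-T^\alpha_t f(x)\right)e^{-\frac{x}{2}}\right|^p x^\alpha\,dx\right)^{\frac1p}<\varepsilon .$$
   Context: For $1\le p<\infty$ and $\alpha>-1$, $L^p_\alpha$ is the space of (classes of) measurable functions $f:\mathbb{R}_+\to\mathbb{R}$ with $$\|f\|_{p,\alpha}:=\left(\int_0^\infty \left|f(x)e^{-\frac{x}{2}}\right|^p x^\alpha\,dx\right)^{\frac1p}<\infty .$$ For $\alpha>-\frac12$ and $t,x\ge 0$, the Laguerre translation of $f$ is $$T_t^\alpha f(x)=T_t^\alpha(f,x)=c_\alpha\int_0^\pi f\left(x+t+2\sqrt{xt}\cos\vartheta\right)e^{-\sqrt{xt}\cos\vartheta}\,j_{\alpha-\frac12}\left(\sqrt{xt}\sin\vartheta\right)\sin^{2\alpha}\vartheta\,d\vartheta,$$ where $c_\alpha=\frac{\Gamma(\alpha+1)}{\Gamma(\alpha+\frac12)\Gamma(\frac12)}$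 and, for $\beta>-1$, $j_\beta$ is the entire Bessel function $$j_\beta(z)=\Gamma(\beta+1)\left(\frac2z\right)^\beta J_\beta(z)=\sum_{k=0}^\infty\frac{(-1)^k\Gamma(\beta+1)}{\Gamma(k+1)\Gamma(k+\beta+1)}\left(\frac z2\right)^{2k}.$$ In particular $T_0^\alpha f=f$. *)

theory Defs
  imports "HOL-Analysis.Analysis"
begin

subsection \<open>The weighted spaces\<close>

text \<open>Valued in \<^typ>\<open>ennreal\<close>, so that a strict bound on the norm includes its finiteness.\<close>

definition laguerre_norm :: "real \<Rightarrow> real \<Rightarrow> real set \<Rightarrow> (real \<Rightarrow> real) \<Rightarrow> ennreal" where
  "laguerre_norm p \<alpha> A f =
     (let I = \<integral>\<^sup>+x\<in>A. ennreal (\<bar>f x * exp (- x / 2)\<bar> powr p * x powr \<alpha>) \<partial>lborel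
      in if I = \<infinity> then \<infinity> else ennreal (enn2real I powr (1 / p)))"

text \<open>
  Functions on the half line are total functions whose values on the negative axis are ignored.
  Borel measurability suffices, because every class of Lebesgue measurable functions modulo null
  sets has a Borel representative.
\<close>

definition laguerre_functions :: "real \<Rightarrow> real \<Rightarrow> (real \<Rightarrow> real) set" where
  "laguerre_functions p \<alpha> =
     {f. set_borel_measurable lborel {0..} f \<and> laguerre_norm p \<alpha> {0..} f < \<infinity>}"

definition laguerre_rel :: "real \<Rightarrow> real \<Rightarrow> ((real \<Rightarrow> real) \<times> (real \<Rightarrow> real)) set" where
  "laguerre_rel p \<alpha> =
     {(f, g). f \<in> laguerre_functions p \<alpha> \<and> g \<in> laguerre_functions p \<alpha> \<and>
              (AE x in lborel. 0 \<le> x \<longrightarrow> f x = g x)}"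

definition laguerre_Lp :: "real \<Rightarrow> real \<Rightarrow> (real \<Rightarrow> real) set set" where
  "laguerre_Lp p \<alpha> = laguerre_functions p \<alpha> // laguerre_rel p \<alpha>"

definition laguerre_dist :: "real \<Rightarrow> real \<Rightarrow> (real \<Rightarrow> real) set \<Rightarrow> (real \<Rightarrow> real) set \<Rightarrow> real" where
  "laguerre_dist p \<alpha> F G =
     (let f = SOME f. f \<in> F; g = SOME g. g \<in> G
      in enn2real (laguerre_norm p \<alpha> {0..} (\<lambda>x. f x - g x)))"


subsection \<open>The Laguerre translation\<close>

definition bessel_j :: "real \<Rightarrow> real \<Rightarrow> real" where
  "bessel_j \<beta> z =
     (\<Sum>k. (- 1) ^ k * Gamma (\<beta> + 1) / (Gamma (real k + 1) * Gamma (real k + \<beta> + 1)) *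
          (z / 2) ^ (2 * k))"

text \<open>
  Acts on representatives, and is meant for \<open>x, t \<ge> 0\<close>, where the argument of \<open>f\<close> is nonnegative.
  At most on a null set of \<open>x\<close> the integrand is not integrable; the value there is \<open>0\<close>.
\<close>

definition laguerre_translation :: "real \<Rightarrow> real \<Rightarrow> (real \<Rightarrow> real) \<Rightarrow> real \<Rightarrow> real" where
  "laguerre_translation \<alpha> t f x =
     Gamma (\<alpha> + 1) / (Gamma (\<alpha> + 1 / 2) * Gamma (1 / 2)) *
     (LINT \<theta>:{0..pi}|lborel.
        f (x + t + 2 * sqrt (x * t) * cos \<theta>) * exp (- (sqrt (x * t) * cos \<theta>)) *
        bessel_j (\<alpha> - 1 / 2) (sqrt (x * t) * sin \<theta>) * sin \<theta> powr (2 * \<alpha>))"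


subsection \<open>The spaces are metric spaces\<close>

lemma powr_sum_le:
  fixes u v a b p :: real
  assumes "1 \<le> p" "0 \<le> u" "0 \<le> v" "0 < a" "0 < b"
  shows "(u + v) powr p \<le>
    (a + b) powr p * (a / (a + b) * (u powr p / a powr p) + b / (a + b) * (v powr p / b powr p))"
proof -
  have edge: "w powr p \<le> (c + d) powr p * (d / (c + d) * (w powr p / d powr p))"
    if "0 \<le> w" "0 < c" "0 < d" for w c d :: real
  proof -
    have "d powr (p - 1) \<le> (c + d) powr (p - 1)"
      using that assms by (intro powr_mono2) auto
    then have "1 \<le> (c + d) powr (p - 1) / d powr (p - 1)"
      using that by simp
    also have "\<dots> = (c + d) powr p * (d / (c + d) / d powr p)"
      using that by (simp add: powr_diff field_simps)
    finally have "w powr p * 1 \<le> w powr p * ((c + d) powr p * (d / (c + d) / d powr p))"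
      by (intro mult_left_mono) auto
    then show ?thesis by (simp add: mult_ac)
  qed
  consider "u = 0" | "v = 0" | "0 < u" "0 < v" using assms by linarith
  then show ?thesis
  proof cases
    case 1 then show ?thesis using edge[of v a b] assms by simp
  next
    case 2 then show ?thesis using edge[of u b a] assms by (simp add: add.commute)
  next
    case 3
    have "((1 - b / (a + b)) *\<^sub>R (u / a) + (b / (a + b)) *\<^sub>R (v / b)) powr p
        \<le> (1 - b / (a + b)) * (u / a) powr p + (b / (a + b)) * (v / b) powr p"
      using 3 assms by (intro convex_onD[OF powr_convex]) auto
    moreover have "1 - b / (a + b) = a / (a + b)" using assms by (simp add: field_simps)
    moreover have "(u / a) powr p = u powr p / a powr p" "(v / b) powr p = v powr p / b powr p"
      using 3 assms by (simp_all add: powr_divide)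
    moreover have "a / (a + b) * (u / a) + b / (a + b) * (v / b) = (u + v) / (a + b)"
      using assms by (simp add: add_divide_distrib)
    ultimately have "((u + v) / (a + b)) powr p \<le>
        a / (a + b) * (u powr p / a powr p) + b / (a + b) * (v powr p / b powr p)"
      by simp
    moreover have "((u + v) / (a + b)) powr p = (u + v) powr p / (a + b) powr p"
      using 3 assms by (simp add: powr_divide)
    ultimately show ?thesis using assms by (simp add: field_simps)
  qed
qed

lemma laguerre_integrand_measurable:
  assumes "set_borel_measurable lborel A f" "A \<in> sets borel"
  shows "(\<lambda>x. ennreal (\<bar>f x * exp (- x / 2)\<bar> powr p * x powr \<alpha>) * indicator A x)
           \<in> borel_measurable lborel"
proof -
  have [measurable]: "(\<lambda>x. indicat_real A x * f x) \<in> borel_measurable borel"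
    using assms(1) by (simp add: set_borel_measurable_def)
  have [measurable]: "A \<in> sets borel" by fact
  have "(\<lambda>x. ennreal (\<bar>f x * exp (- x / 2)\<bar> powr p * x powr \<alpha>) * indicator A x) =
        (\<lambda>x. ennreal (\<bar>(indicat_real A x * f x) * exp (- x / 2)\<bar> powr p * x powr \<alpha>) * indicator A x)"
    by (auto simp: indicator_def)
  then show ?thesis by simp
qed

lemma laguerre_norm_le_iff:
  assumes "1 \<le> p" "0 \<le> c"
  shows "laguerre_norm p \<alpha> A f \<le> ennreal c \<longleftrightarrow>
    (\<integral>\<^sup>+x\<in>A. ennreal (\<bar>f x * exp (- x / 2)\<bar> powr p * x powr \<alpha>) \<partial>lborel) \<le> ennreal (c powr p)"
    (is "_ \<longleftrightarrow> ?I \<le> _")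
proof (cases "?I = \<infinity>")
  case True
  then show ?thesis
    by (simp add: laguerre_norm_def Let_def top_unique)
next
  case False
  then obtain r where r: "0 \<le> r" "?I = ennreal r"
    by (cases ?I) auto
  have "r powr (1 / p) \<le> c \<longleftrightarrow> r \<le> c powr p"
  proof
    assume "r powr (1 / p) \<le> c"
    then have "(r powr (1 / p)) powr p \<le> c powr p" using assms by (intro powr_mono2) auto
    then show "r \<le> c powr p" using r assms by (simp add: powr_powr)
  next
    assume "r \<le> c powr p"
    then have "r powr (1 / p) \<le> (c powr p) powr (1 / p)" using assms r by (intro powr_mono2) auto
    then show "r powr (1 / p) \<le> c" using assms by (simp add: powr_powr)
  qed
  then show ?thesis
    using r assms by (simp add: laguerre_norm_def Let_def)
qed

lemma laguerre_norm_add_le: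
  assumes p: "1 \<le> p" and A: "A \<in> sets borel"
    and f: "set_borel_measurable lborel A f" and g: "set_borel_measurable lborel A g"
    and a: "laguerre_norm p \<alpha> A f \<le> ennreal a" "0 \<le> a"
    and b: "laguerre_norm p \<alpha> A g \<le> ennreal b" "0 \<le> b"
  shows "laguerre_norm p \<alpha> A (\<lambda>x. f x + g x) \<le> ennreal (a + b)"
proof (rule ennreal_le_epsilon)
  fix e :: real assume e: "0 < e"
  define a' b' where "a' = a + e / 2" and "b' = b + e / 2"
  have pos: "0 < a'" "0 < b'" using a b e by (auto simp: a'_def b'_def)
  let ?I = "\<lambda>f. \<integral>\<^sup>+x\<in>A. ennreal (\<bar>f x * exp (- x / 2)\<bar> powr p * x powr \<alpha>) \<partial>lborel"
  define C where "C = (a' + b') powr p"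
  define c d where "c = C * (a' / (a' + b') / a' powr p)" and "d = C * (b' / (a' + b') / b' powr p)"
  have cd: "0 \<le> c" "0 \<le> d" using pos by (auto simp: c_def d_def C_def)
  have "laguerre_norm p \<alpha> A f \<le> ennreal a'" "laguerre_norm p \<alpha> A g \<le> ennreal b'"
    using a b e by (auto simp: a'_def b'_def intro: order_trans ennreal_leI)
  then have If: "?I f \<le> ennreal (a' powr p)" and Ig: "?I g \<le> ennreal (b' powr p)"
    using laguerre_norm_le_iff[OF p] pos by auto
  have pt: "\<bar>(f x + g x) * exp (- x / 2)\<bar> powr p * x powr \<alpha> \<le>
      c * (\<bar>f x * exp (- x / 2)\<bar> powr p * x powr \<alpha>) + d * (\<bar>g x * exp (- x / 2)\<bar> powr p * x powr \<alpha>)"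
    for x
  proof -
    let ?u = "\<bar>f x * exp (- x / 2)\<bar>" and ?v = "\<bar>g x * exp (- x / 2)\<bar>"
    have "\<bar>(f x + g x) * exp (- x / 2)\<bar> \<le> ?u + ?v"
      using abs_triangle_ineq[of "f x * exp (- x / 2)" "g x * exp (- x / 2)"]
      by (simp add: distrib_right)
    then have "\<bar>(f x + g x) * exp (- x / 2)\<bar> powr p \<le> (?u + ?v) powr p"
      using p by (intro powr_mono2) auto
    also have "\<dots> \<le> c * ?u powr p + d * ?v powr p"
      using powr_sum_le[OF p, of ?u ?v a' b'] pos
      by (simp add: c_def d_def C_def distrib_left mult_ac)
    finally have "\<bar>(f x + g x) * exp (- x / 2)\<bar> powr p * x powr \<alpha> \<le>
        (c * ?u powr p + d * ?v powr p) * x powr \<alpha>"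
      by (intro mult_right_mono) auto
    then show ?thesis by (simp only: distrib_right mult.assoc)
  qed
  have "?I (\<lambda>x. f x + g x) \<le>
      (\<integral>\<^sup>+x. ennreal c * (ennreal (\<bar>f x * exp (- x / 2)\<bar> powr p * x powr \<alpha>) * indicator A x) +
          ennreal d * (ennreal (\<bar>g x * exp (- x / 2)\<bar> powr p * x powr \<alpha>) * indicator A x) \<partial>lborel)"
    using pt cd
    by (intro nn_integral_mono)
       (auto simp: indicator_def ennreal_mult[symmetric] ennreal_plus[symmetric]
             simp del: ennreal_plus intro!: ennreal_leI)
  also have "\<dots> = ennreal c * ?I f + ennreal d * ?I g"
    using laguerre_integrand_measurable[OF f A] laguerre_integrand_measurable[OF g A]
    by (simp add: nn_integral_add nn_integral_cmult)
  also have "\<dots> \<le> ennreal c * ennreal (a' powr p) + ennreal d * ennreal (b' powr p)"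
    using If Ig by (intro add_mono mult_left_mono) auto
  also have "\<dots> = ennreal (c * a' powr p + d * b' powr p)"
    using cd by (simp add: ennreal_mult)
  also have "c * a' powr p + d * b' powr p = C * (a' / (a' + b') + b' / (a' + b'))"
    using pos unfolding c_def d_def distrib_left by simp
  also have "a' / (a' + b') + b' / (a' + b') = 1"
    using pos by (simp add: add_divide_distrib[symmetric])
  finally have "?I (\<lambda>x. f x + g x) \<le> ennreal ((a' + b') powr p)" by (simp add: C_def)
  then have "laguerre_norm p \<alpha> A (\<lambda>x. f x + g x) \<le> ennreal (a' + b')"
    using pos by (subst laguerre_norm_le_iff[OF p]) (simp_all del: ennreal_plus)
  also have "ennreal (a' + b') = ennreal (a + b) + ennreal e"
    using a b e by (simp add: a'_def b'_def ennreal_plus[symmetric] del: ennreal_plus)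
  finally show "laguerre_norm p \<alpha> A (\<lambda>x. f x + g x) \<le> ennreal (a + b) + ennreal e" .
qed

lemma laguerre_norm_uminus: "laguerre_norm p \<alpha> A (\<lambda>x. - f x) = laguerre_norm p \<alpha> A f"
  by (simp add: laguerre_norm_def)

lemma laguerre_norm_minus_commute:
  "laguerre_norm p \<alpha> A (\<lambda>x. f x - g x) = laguerre_norm p \<alpha> A (\<lambda>x. g x - f x)"
  using laguerre_norm_uminus[of p \<alpha> A "\<lambda>x. f x - g x"] by simp

lemma laguerre_functions_diff:
  assumes "1 \<le> p" "f \<in> laguerre_functions p \<alpha>" "g \<in> laguerre_functions p \<alpha>"
  shows "(\<lambda>x. f x - g x) \<in> laguerre_functions p \<alpha>"
proof -
  have f: "set_borel_measurable lborel {0..} f" and g: "set_borel_measurable lborel {0..} g"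
    using assms by (auto simp: laguerre_functions_def)
  then have m: "set_borel_measurable lborel {0..} (\<lambda>x. f x - g x)"
    and g': "set_borel_measurable lborel {0..} (\<lambda>x. - g x)"
    by (auto simp: set_borel_measurable_def right_diff_distrib)
  obtain a where a: "0 \<le> a" "laguerre_norm p \<alpha> {0..} f = ennreal a"
    using assms(2) by (cases "laguerre_norm p \<alpha> {0..} f") (auto simp: laguerre_functions_def)
  obtain b where b: "0 \<le> b" "laguerre_norm p \<alpha> {0..} g = ennreal b"
    using assms(3) by (cases "laguerre_norm p \<alpha> {0..} g") (auto simp: laguerre_functions_def)
  have "laguerre_norm p \<alpha> {0..} (\<lambda>x. f x + - g x) \<le> ennreal (a + b)"
    using a b by (intro laguerre_norm_add_le assms f g') (auto simp: laguerre_norm_uminus)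
  also have "\<dots> < \<infinity>" by simp
  finally show ?thesis using m by (simp add: laguerre_functions_def)
qed

lemma laguerre_norm_eq_0_iff:
  assumes "1 \<le> p" "set_borel_measurable lborel {0..} f"
  shows "laguerre_norm p \<alpha> {0..} f = 0 \<longleftrightarrow> (AE x in lborel. 0 \<le> x \<longrightarrow> f x = 0)"
proof -
  have "laguerre_norm p \<alpha> {0..} f = 0 \<longleftrightarrow>
      (\<integral>\<^sup>+x\<in>{0..}. ennreal (\<bar>f x * exp (- x / 2)\<bar> powr p * x powr \<alpha>) \<partial>lborel) = 0"
    using laguerre_norm_le_iff[OF assms(1), of 0 \<alpha> "{0..}" f] by simp
  also have "\<dots> \<longleftrightarrow> (AE x in lborel.
      ennreal (\<bar>f x * exp (- x / 2)\<bar> powr p * x powr \<alpha>) * indicator {0..} x = 0)"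
    by (intro nn_integral_0_iff_AE laguerre_integrand_measurable assms) auto
  also have "\<dots> \<longleftrightarrow> (AE x in lborel. 0 \<le> x \<longrightarrow> f x = 0)"
  proof -
    have ne: "AE x in lborel. x \<noteq> (0::real)" by (rule AE_lborel_singleton)
    have *: "ennreal (\<bar>f x * exp (- x / 2)\<bar> powr p * x powr \<alpha>) * indicator {0..} x = 0 \<longleftrightarrow>
        (0 \<le> x \<longrightarrow> f x = 0)" if "x \<noteq> 0" for x
    proof (cases "0 \<le> x")
      case True
      have "0 \<le> \<bar>f x * exp (- x / 2)\<bar> powr p * x powr \<alpha>" by simp
      then have "\<bar>f x * exp (- x / 2)\<bar> powr p * x powr \<alpha> \<le> 0 \<longleftrightarrow>
          \<bar>f x * exp (- x / 2)\<bar> powr p * x powr \<alpha> = 0" by linarith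
      then show ?thesis using that True by (simp add: ennreal_eq_0_iff)
    qed simp
    show ?thesis
    proof
      assume "AE x in lborel. ennreal (\<bar>f x * exp (- x / 2)\<bar> powr p * x powr \<alpha>) * indicator {0..} x = 0"
      with ne show "AE x in lborel. 0 \<le> x \<longrightarrow> f x = 0"
        by eventually_elim (use * in blast)
    next
      assume "AE x in lborel. 0 \<le> x \<longrightarrow> f x = 0"
      with ne show "AE x in lborel. ennreal (\<bar>f x * exp (- x / 2)\<bar> powr p * x powr \<alpha>) * indicator {0..} x = 0"
        by eventually_elim (use * in blast)
    qed
  qed
  finally show ?thesis .
qed

lemma equiv_laguerre_rel: "equiv (laguerre_functions p \<alpha>) (laguerre_rel p \<alpha>)"
proof (rule equivI)
  show "laguerre_rel p \<alpha> \<subseteq> laguerre_functions p \<alpha> \<times> laguerre_functions p \<alpha>"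
    by (auto simp: laguerre_rel_def)
  show "refl_on (laguerre_functions p \<alpha>) (laguerre_rel p \<alpha>)"
    by (auto simp: refl_on_def laguerre_rel_def)
  show "sym (laguerre_rel p \<alpha>)"
    by (auto simp: sym_def laguerre_rel_def elim: eventually_mono)
  show "trans (laguerre_rel p \<alpha>)"
  proof (rule transI)
    fix f g h assume fg: "(f, g) \<in> laguerre_rel p \<alpha>" and gh: "(g, h) \<in> laguerre_rel p \<alpha>"
    then have "AE x in lborel. 0 \<le> x \<longrightarrow> f x = g x" "AE x in lborel. 0 \<le> x \<longrightarrow> g x = h x"
      by (auto simp: laguerre_rel_def)
    then have "AE x in lborel. 0 \<le> x \<longrightarrow> f x = h x" by eventually_elim simp
    then show "(f, h) \<in> laguerre_rel p \<alpha>" using fg gh by (auto simp: laguerre_rel_def)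
  qed
qed

lemma laguerre_Lp_some:
  assumes "F \<in> laguerre_Lp p \<alpha>"
  shows "(SOME f. f \<in> F) \<in> F" and "(SOME f. f \<in> F) \<in> laguerre_functions p \<alpha>"
proof -
  have "F \<noteq> {}" "F \<subseteq> laguerre_functions p \<alpha>"
    using assms in_quotient_imp_non_empty[OF equiv_laguerre_rel]
      in_quotient_imp_subset[OF equiv_laguerre_rel] by (auto simp: laguerre_Lp_def)
  then show "(SOME f. f \<in> F) \<in> F" by (simp add: some_in_eq)
  with \<open>F \<subseteq> _\<close> show "(SOME f. f \<in> F) \<in> laguerre_functions p \<alpha>" by blast
qed

lemma Metric_space_laguerre:
  assumes p: "1 \<le> p"
  shows "Metric_space (laguerre_Lp p \<alpha>) (laguerre_dist p \<alpha>)"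
proof
  fix F G H :: "(real \<Rightarrow> real) set"
  show "0 \<le> laguerre_dist p \<alpha> F G" by (simp add: laguerre_dist_def Let_def)
  show "laguerre_dist p \<alpha> F G = laguerre_dist p \<alpha> G F"
    unfolding laguerre_dist_def Let_def by (subst laguerre_norm_minus_commute) (rule refl)
  assume F: "F \<in> laguerre_Lp p \<alpha>" and G: "G \<in> laguerre_Lp p \<alpha>"
  define f g h where "f = (SOME f. f \<in> F)" and "g = (SOME f. f \<in> G)" and "h = (SOME f. f \<in> H)"
  note fF = laguerre_Lp_some[OF F, folded f_def] and gG = laguerre_Lp_some[OF G, folded g_def]
  have fg: "(\<lambda>x. f x - g x) \<in> laguerre_functions p \<alpha>" using fF gG p by (intro laguerre_functions_diff)
  have "laguerre_dist p \<alpha> F G = 0 \<longleftrightarrow> laguerre_norm p \<alpha> {0..} (\<lambda>x. f x - g x) = 0"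
    using fg by (auto simp: laguerre_dist_def f_def g_def enn2real_eq_0_iff laguerre_functions_def)
  also have "\<dots> \<longleftrightarrow> (AE x in lborel. 0 \<le> x \<longrightarrow> f x = g x)"
    using laguerre_norm_eq_0_iff[OF p] fg by (auto simp: laguerre_functions_def)
  also have "\<dots> \<longleftrightarrow> (f, g) \<in> laguerre_rel p \<alpha>"
    using fF gG by (simp add: laguerre_rel_def)
  also have "\<dots> \<longleftrightarrow> F = G"
    using quotient_eq_iff[OF equiv_laguerre_rel] F G fF gG by (auto simp: laguerre_Lp_def)
  finally show "laguerre_dist p \<alpha> F G = 0 \<longleftrightarrow> F = G" .
  assume H: "H \<in> laguerre_Lp p \<alpha>"
  note hH = laguerre_Lp_some[OF H, folded h_def]
  have gh: "(\<lambda>x. g x - h x) \<in> laguerre_functions p \<alpha>" using gG hH p by (intro laguerre_functions_diff)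
  have "laguerre_norm p \<alpha> {0..} (\<lambda>x. (f x - g x) + (g x - h x)) \<le>
      ennreal (laguerre_dist p \<alpha> F G + laguerre_dist p \<alpha> G H)"
    using fg gh
    by (intro laguerre_norm_add_le p)
       (auto simp: laguerre_functions_def laguerre_dist_def f_def[symmetric] g_def[symmetric] h_def[symmetric] Let_def)
  then have "enn2real (laguerre_norm p \<alpha> {0..} (\<lambda>x. (f x - g x) + (g x - h x))) \<le>
      laguerre_dist p \<alpha> F G + laguerre_dist p \<alpha> G H"
    by (intro enn2real_leI) (auto simp: laguerre_dist_def Let_def)
  then show "laguerre_dist p \<alpha> F H \<le> laguerre_dist p \<alpha> F G + laguerre_dist p \<alpha> G H"
    by (simp add: laguerre_dist_def[of p \<alpha> F H] Let_def f_def[symmetric] h_def[symmetric])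
qed

end

theory Submission
  imports Defs
begin

text \<open>
  A Kolmogorov--Riesz theorem, proved by mollification. Two properties of the translation
  \<open>T\<^sub>t f\<close> carry it.

  It is bounded: the norm of \<open>T\<^sub>t f\<close> is at most \<open>exp (t / 2)\<close> times that of \<open>f\<close>
  (\<open>laguerre_translation_norm_le\<close>). Indeed, with \<open>z = x + t + 2 \<surd>(x t) cos \<theta>\<close> and
  \<open>F(z) = f(z) exp (- z / 2)\<close>, the function \<open>exp (- (x + t) / 2) T\<^sub>t f(x)\<close> is an average of
  \<open>F(z)\<close> over \<open>\<theta>\<close>, weighted by a Bessel factor. The Bessel factor is at most one in modulus for
  \<open>\<alpha> \<ge> 0\<close> by an energy argument (\<open>bessel_series_abs_le_1\<close>), the average is against a
  probability measure, and it preserves integrals against \<open>x\<^sup>\<alpha> dx\<close> because in suitable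
  coordinates it is a shift of one variable (\<open>nn_integral_generalized_translation\<close>).

  It is symmetric: \<open>T\<^sub>t f(x) = T\<^sub>x f(t)\<close>. So the mean \<open>A f(x)\<close> of \<open>T\<^sub>h f(x)\<close> over
  \<open>h \<in> [0, \<delta>]\<close> is a bounded linear functional of \<open>T\<^sub>x f\<close>.

  Suppose that tails are uniformly small and translates are equicontinuous. At \<open>t = 0\<close>
  equicontinuity says that the means are uniformly close to the functions
  (\<open>laguerre_mean_approximates\<close>); at \<open>t = x\<close>, through the symmetry, it says that the means
  are equicontinuous functions of \<open>x\<close> on bounded intervals (\<open>laguerre_mean_diff_le\<close>). They
  are uniformly bounded there as well, so their values on a finite grid, up to rounding, sort the
  functions into finitely many cells of small diameter (\<open>finite_discretization\<close>).

  Conversely, both properties hold for a single function: the tails by dominated convergence, the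
  continuity of translates by approximation with continuous functions of bounded support
  (\<open>laguerre_translation_uniformly_continuous\<close>). Both pass from a finite net to the set, since
  the translations by bounded \<open>t\<close> are uniformly bounded.
\<close>

section \<open>The entire Bessel function is bounded by one\<close>

definition bessel_coeff :: "real \<Rightarrow> nat \<Rightarrow> real" where
  "bessel_coeff \<beta> k = (- 1) ^ k * Gamma (\<beta> + 1) / (Gamma (real k + 1) * Gamma (real k + \<beta> + 1))"

definition bessel_series :: "real \<Rightarrow> real \<Rightarrow> real" where
  "bessel_series \<beta> y = (\<Sum>k. bessel_coeff \<beta> k * y ^ k)"

lemma bessel_j_eq_series: "bessel_j \<beta> z = bessel_series \<beta> (z\<^sup>2 / 4)"
  by (simp add: bessel_j_def bessel_series_def bessel_coeff_def power_mult power_divide)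

lemma bessel_coeff_0:
  assumes "- 1 < \<beta>"
  shows "bessel_coeff \<beta> 0 = 1"
proof -
  have "0 < Gamma (\<beta> + 1)" using assms by (intro Gamma_real_pos) simp
  then have "Gamma (\<beta> + 1) \<noteq> 0" by (rule less_imp_neq[symmetric])
  then show ?thesis by (simp add: bessel_coeff_def del: Gamma_eq_zero_iff)
qed

lemma bessel_coeff_Suc:
  assumes "- 1 < \<beta>"
  shows "real (Suc k) * (real (Suc k) + \<beta>) * bessel_coeff \<beta> (Suc k) = - bessel_coeff \<beta> k"
proof -
  have 1: "Gamma (real (Suc k) + 1) = real (Suc k) * Gamma (real k + 1)"
  proof -
    have "real k + 1 \<notin> \<int>\<^sub>\<le>\<^sub>0" by (auto elim!: nonpos_Ints_cases)
    then show ?thesis using Gamma_plus1[of "real k + 1"] by (simp add: add.commute)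
  qed
  have "real k + \<beta> + 1 \<notin> \<int>\<^sub>\<le>\<^sub>0" using assms by (auto elim!: nonpos_Ints_cases)
  then have 2: "Gamma (real (Suc k) + \<beta> + 1) = (real (Suc k) + \<beta>) * Gamma (real k + \<beta> + 1)"
    using Gamma_plus1[of "real k + \<beta> + 1"] by (simp add: algebra_simps)
  have "n * m * ((- 1) ^ Suc k * G / (n * A * (m * B))) = - ((- 1) ^ k * G / (A * B))"
    if "n \<noteq> 0" "m \<noteq> 0" for n m G A B :: real
    using that by simp
  moreover have "real (Suc k) + \<beta> \<noteq> 0" using assms by auto
  ultimately show ?thesis
    unfolding bessel_coeff_def 1 2 by (metis nat.simps(3) of_nat_eq_0_iff)
qed

lemma summable_bessel_coeff:
  assumes "- 1 < \<beta>"
  shows "summable (\<lambda>k. bessel_coeff \<beta> k * y ^ k)"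
proof -
  define N where "N = nat \<lceil>2 * \<bar>y\<bar> - \<beta>\<rceil> + 1"
  have "\<bar>bessel_coeff \<beta> (Suc k) * y ^ Suc k\<bar> \<le> 1 / 2 * \<bar>bessel_coeff \<beta> k * y ^ k\<bar>" if "N \<le> k" for k
  proof -
    have "2 * \<bar>y\<bar> \<le> real (Suc k) + \<beta>" using that by (simp add: N_def) linarith
    then have *: "2 * \<bar>y\<bar> \<le> real (Suc k) * (real (Suc k) + \<beta>)"
      using mult_right_mono[of 1 "real (Suc k)" "real (Suc k) + \<beta>"]
      by (simp del: of_nat_Suc) (simp; linarith)
    have "0 \<le> real (Suc k) * (real (Suc k) + \<beta>)" using * by linarith
    then have "\<bar>bessel_coeff \<beta> k\<bar> = real (Suc k) * (real (Suc k) + \<beta>) * \<bar>bessel_coeff \<beta> (Suc k)\<bar>"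
      using bessel_coeff_Suc[OF assms, of k]
      by (metis abs_minus_cancel abs_mult abs_of_nonneg)
    moreover have "2 * \<bar>y\<bar> * \<bar>bessel_coeff \<beta> (Suc k)\<bar> \<le> real (Suc k) * (real (Suc k) + \<beta>) * \<bar>bessel_coeff \<beta> (Suc k)\<bar>"
      using * by (intro mult_right_mono) auto
    ultimately have "2 * \<bar>y\<bar> * \<bar>bessel_coeff \<beta> (Suc k)\<bar> * \<bar>y\<bar> ^ k \<le> \<bar>bessel_coeff \<beta> k\<bar> * \<bar>y\<bar> ^ k"
      by (intro mult_right_mono) auto
    then show ?thesis by (simp add: abs_mult power_abs mult_ac)
  qed
  then show ?thesis by (intro summable_ratio_test[of "1/2" N]) auto
qed

text \<open>
  The bound by one is a conservation law with friction. The series \<open>g\<close> satisfies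
  \<open>y g'' + (\<beta> + 1) g' + g = 0\<close>, so its energy \<open>g\<^sup>2 + y g'\<^sup>2\<close> has the derivative
  \<open>- (2 \<beta> + 1) g'\<^sup>2\<close>, which is nonpositive exactly when \<open>\<beta> \<ge> - 1/2\<close>; and the energy is
  one at the origin.
\<close>

lemma bessel_series_abs_le_1:
  assumes "- 1 / 2 \<le> \<beta>" "0 \<le> y"
  shows "\<bar>bessel_series \<beta> y\<bar> \<le> 1"
proof -
  have \<beta>: "- 1 < \<beta>" using assms by linarith
  define a g g1 g2 where "a = bessel_coeff \<beta>" and "g = bessel_series \<beta>"
    and "g1 = (\<lambda>y. \<Sum>k. diffs a k * y ^ k)" and "g2 = (\<lambda>y. \<Sum>k. diffs (diffs a) k * y ^ k)"
  have s0: "summable (\<lambda>k. a k * y ^ k)" for y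
    using summable_bessel_coeff[OF \<beta>] by (simp add: a_def)
  have s1: "summable (\<lambda>k. diffs a k * y ^ k)" for y
    by (rule termdiff_converges_all[OF s0])
  have s2: "summable (\<lambda>k. diffs (diffs a) k * y ^ k)" for y
    by (rule termdiff_converges_all[OF s1])
  have d0: "(g has_real_derivative g1 y) (at y)" for y
    using termdiffs_strong_converges_everywhere[OF s0, of y]
    by (simp add: g_def g1_def bessel_series_def[abs_def] a_def)
  have d1: "(g1 has_real_derivative g2 y) (at y)" for y
    using termdiffs_strong_converges_everywhere[OF s1, of y] by (simp add: g1_def g2_def)
  \<comment> \<open>the recursion for the coefficients, read as a differential equation\<close>
  have ode: "y * g2 y + (\<beta> + 1) * g1 y + g y = 0" for y
  proof -
    have y2: "(\<lambda>k. real k * (real (Suc k) * a (Suc k)) * y ^ k) sums (y * g2 y)"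
    proof -
      have "(\<lambda>k. diffs (diffs a) k * y ^ k * y) sums (g2 y * y)"
        unfolding g2_def by (intro sums_mult2 summable_sums s2)
      then have "(\<lambda>k. real (Suc k) * (real (Suc (Suc k)) * a (Suc (Suc k))) * y ^ Suc k) sums (y * g2 y)"
        by (simp add: diffs_def mult_ac)
      then show ?thesis by (subst (asm) sums_Suc_iff) simp
    qed
    have "(\<lambda>k. real k * (real (Suc k) * a (Suc k)) * y ^ k + (\<beta> + 1) * (diffs a k * y ^ k) + a k * y ^ k)
        sums (y * g2 y + (\<beta> + 1) * g1 y + g y)"
      unfolding g1_def g_def bessel_series_def
      by (intro sums_add y2 sums_mult summable_sums s1) (use s0[of y] in \<open>simp add: a_def summable_sums\<close>)
    moreover have "real k * (real (Suc k) * a (Suc k)) * y ^ k + (\<beta> + 1) * (diffs a k * y ^ k) + a k * y ^ k = 0" for k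
    proof -
      have "real k * (real (Suc k) * a (Suc k)) * y ^ k + (\<beta> + 1) * (diffs a k * y ^ k) + a k * y ^ k
          = (real (Suc k) * (real (Suc k) + \<beta>) * a (Suc k) + a k) * y ^ k"
        by (simp add: diffs_def algebra_simps)
      then show ?thesis using bessel_coeff_Suc[OF \<beta>, of k] by (simp add: a_def)
    qed
    ultimately have "(\<lambda>k. 0) sums (y * g2 y + (\<beta> + 1) * g1 y + g y)" by simp
    then show ?thesis by (simp add: sums_unique2[OF _ sums_zero])
  qed
  define E where "E = (\<lambda>y. (g y)\<^sup>2 + y * (g1 y)\<^sup>2)"
  have dE: "(E has_real_derivative (- (2 * \<beta> + 1) * (g1 y)\<^sup>2)) (at y)" for y
  proof -
    have "(E has_real_derivative (2 * g y * g1 y + (g1 y)\<^sup>2 + y * (2 * g1 y * g2 y))) (at y)"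
      unfolding E_def by (auto intro!: derivative_eq_intros d0 d1 simp: power2_eq_square)
    also have "2 * g y * g1 y + (g1 y)\<^sup>2 + y * (2 * g1 y * g2 y)
        = - (2 * \<beta> + 1) * (g1 y)\<^sup>2 + 2 * g1 y * (y * g2 y + (\<beta> + 1) * g1 y + g y)"
      by (simp add: algebra_simps power2_eq_square)
    finally show ?thesis by (simp add: ode)
  qed
  have "E y \<le> E 0"
  proof (rule DERIV_nonpos_imp_nonincreasing[OF assms(2)])
    fix x
    have "- (2 * \<beta> + 1) * (g1 x)\<^sup>2 \<le> 0" using assms(1) by (intro mult_nonpos_nonneg) auto
    then show "\<exists>d. (E has_real_derivative d) (at x) \<and> d \<le> 0" using dE by blast
  qed
  also have "E 0 = 1"
    using bessel_coeff_0[OF \<beta>] powser_zero[of "bessel_coeff \<beta>"]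
    by (simp add: E_def g_def bessel_series_def)
  finally have "(g y)\<^sup>2 + y * (g1 y)\<^sup>2 \<le> 1" by (simp add: E_def)
  moreover have "0 \<le> y * (g1 y)\<^sup>2" using assms by simp
  ultimately have "(g y)\<^sup>2 \<le> 1" by linarith
  then show ?thesis by (simp add: g_def abs_square_le_1)
qed

lemma bessel_j_abs_le_1: "- 1 / 2 \<le> \<beta> \<Longrightarrow> \<bar>bessel_j \<beta> z\<bar> \<le> 1"
  by (simp add: bessel_j_eq_series bessel_series_abs_le_1)

lemma bessel_j_0: "- 1 < \<beta> \<Longrightarrow> bessel_j \<beta> 0 = 1"
  using powser_zero[of "bessel_coeff \<beta>"]
  by (simp add: bessel_j_eq_series bessel_series_def bessel_coeff_0)

lemma continuous_on_bessel_j: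
  assumes "- 1 < \<beta>" "continuous_on S f"
  shows "continuous_on S (\<lambda>x. bessel_j \<beta> (f x))"
proof -
  have "isCont (bessel_series \<beta>) y" for y
    using termdiffs_strong_converges_everywhere[OF summable_bessel_coeff[OF assms(1)], of y]
    by (auto simp: bessel_series_def[abs_def] intro: DERIV_isCont)
  then have "continuous_on UNIV (bessel_series \<beta>)"
    by (simp add: continuous_at_imp_continuous_on)
  then have "continuous_on S (\<lambda>x. bessel_series \<beta> ((f x)\<^sup>2 / 4))"
    by (rule continuous_on_compose2) (auto intro!: continuous_intros assms)
  then show ?thesis by (simp add: bessel_j_eq_series)
qed

section \<open>The averaging measure of the translation\<close>

definition angle_const :: "real \<Rightarrow> real" where
  "angle_const \<alpha> = Gamma (\<alpha> + 1) / (Gamma (\<alpha> + 1 / 2) * Gamma (1 / 2))"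

definition angle_density :: "real \<Rightarrow> real \<Rightarrow> real" where
  "angle_density \<alpha> \<theta> = indicator {0..pi} \<theta> * (angle_const \<alpha> * sin \<theta> powr (2 * \<alpha>))"

definition angle_measure :: "real \<Rightarrow> real measure" where
  "angle_measure \<alpha> = density lborel (\<lambda>\<theta>. ennreal (angle_density \<alpha> \<theta>))"

lemma sets_angle_measure [measurable_cong, simp]: "sets (angle_measure \<alpha>) = sets borel"
  by (simp add: angle_measure_def)

lemma space_angle_measure [simp]: "space (angle_measure \<alpha>) = UNIV"
  by (simp add: angle_measure_def)

lemma angle_density_measurable [measurable]: "angle_density \<alpha> \<in> borel_measurable borel"
  unfolding angle_density_def[abs_def] by measurable

lemma angle_const_nonneg: "- 1 / 2 < \<alpha> \<Longrightarrow> 0 \<le> angle_const \<alpha>"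
  unfolding angle_const_def
  by (intro divide_nonneg_nonneg mult_nonneg_nonneg) (auto intro!: less_imp_le[OF Gamma_real_pos])

lemma angle_density_nonneg: "- 1 / 2 < \<alpha> \<Longrightarrow> 0 \<le> angle_density \<alpha> \<theta>"
  by (simp add: angle_density_def angle_const_nonneg)

text \<open>
  The angular average becomes an average over \<open>u = - \<surd>x cos \<theta>\<close> against a power of
  \<open>x - u\<^sup>2\<close>. The minus sign makes the substitution increasing.
\<close>

lemma nn_integral_cos_substitution:
  fixes \<phi> :: "real \<Rightarrow> ennreal"
  assumes [measurable]: "\<phi> \<in> borel_measurable borel" and x: "0 < x"
  shows "(\<integral>\<^sup>+\<theta>. \<phi> (- (sqrt x * cos \<theta>)) * ennreal (x powr \<alpha> * sin \<theta> powr (2 * \<alpha>)) * indicator {0..pi} \<theta> \<partial>lborel) =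
    (\<integral>\<^sup>+u. \<phi> u * ennreal ((x - u\<^sup>2) powr (\<alpha> - 1 / 2)) * indicator {- sqrt x..sqrt x} u \<partial>lborel)"
proof -
  let ?g = "\<lambda>\<theta>. - (sqrt x * cos \<theta>)" and ?f = "\<lambda>u. \<phi> u * ennreal ((x - u\<^sup>2) powr (\<alpha> - 1 / 2))"
  have "(\<integral>\<^sup>+u. ?f u * indicator {?g 0..?g pi} u \<partial>lborel) =
      (\<integral>\<^sup>+\<theta>. ?f (?g \<theta>) * ennreal (sqrt x * sin \<theta>) * indicator {0..pi} \<theta> \<partial>lborel)"
    by (rule nn_integral_substitution_aux)
       (auto intro!: derivative_eq_intros continuous_intros mult_nonneg_nonneg sin_ge_zero simp: x less_imp_le)
  also have "\<dots> = (\<integral>\<^sup>+\<theta>. \<phi> (?g \<theta>) * ennreal (x powr \<alpha> * sin \<theta> powr (2 * \<alpha>)) * indicator {0..pi} \<theta> \<partial>lborel)"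
  proof (rule nn_integral_cong)
    fix \<theta> :: real
    have "(x - (?g \<theta>)\<^sup>2) powr (\<alpha> - 1 / 2) * (sqrt x * sin \<theta>) = x powr \<alpha> * sin \<theta> powr (2 * \<alpha>)"
      if "0 < sin \<theta>"
    proof -
      have "x - (?g \<theta>)\<^sup>2 = x * (1 - (cos \<theta>)\<^sup>2)"
        using x by (simp add: power_mult_distrib algebra_simps)
      also have "\<dots> = x * (sin \<theta> powr 2)"
        using that by (simp add: sin_squared_eq[symmetric])
      finally have e: "x - (?g \<theta>)\<^sup>2 = x * (sin \<theta> powr 2)" .
      have "(x - (?g \<theta>)\<^sup>2) powr (\<alpha> - 1 / 2) = x powr (\<alpha> - 1 / 2) * sin \<theta> powr (2 * \<alpha> - 1)"
        using that x unfolding e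
        by (simp only: powr_mult powr_powr less_imp_le powr_ge_zero) (simp add: algebra_simps)
      then show ?thesis
        using that x by (simp add: powr_diff powr_half_sqrt[symmetric])
    qed
    then have *: "ennreal ((x - (?g \<theta>)\<^sup>2) powr (\<alpha> - 1 / 2)) * ennreal (sqrt x * sin \<theta>) =
        ennreal (x powr \<alpha> * sin \<theta> powr (2 * \<alpha>))" if "\<theta> \<in> {0..pi}"
      using sin_ge_zero[of \<theta>] that x by (cases "sin \<theta> = 0") (auto simp: ennreal_mult[symmetric])
    show "?f (?g \<theta>) * ennreal (sqrt x * sin \<theta>) * indicator {0..pi} \<theta> =
        \<phi> (?g \<theta>) * ennreal (x powr \<alpha> * sin \<theta> powr (2 * \<alpha>)) * indicator {0..pi} \<theta>"
      using * by (cases "\<theta> \<in> {0..pi}") (auto simp: mult.assoc)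
  qed
  finally show ?thesis by simp
qed

text \<open>
  The substitution \<open>t = (1 - cos \<theta>) / 2\<close> turns the total mass into the Beta integral
  with both parameters \<open>\<alpha> + 1 / 2\<close>, which Legendre duplication evaluates.
\<close>

lemma emeasure_angle_measure_UNIV:
  assumes "- 1 / 2 < \<alpha>"
  shows "emeasure (angle_measure \<alpha>) UNIV = 1"
proof -
  define a where "a = \<alpha> + 1 / 2"
  have a: "0 < a" using assms by (simp add: a_def)
  define C where "C = angle_const \<alpha>"
  have pos: "0 < Gamma a" "0 < Gamma (a + 1 / 2)" "0 < Gamma (2 * a)" using a by (auto intro!: Gamma_real_pos)
  have Beta: "Beta a a = Gamma a * Gamma a / Gamma (2 * a)" by (simp only: Beta_def mult_2)
  have C: "0 \<le> C" unfolding C_def using assms by (rule angle_const_nonneg)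
  let ?f = "\<lambda>t::real. ennreal (t powr (a - 1) * (1 - t) powr (a - 1))"
  let ?g = "\<lambda>\<theta>. (1 - cos \<theta>) / 2"
  have "ennreal (Beta a a) = (\<integral>\<^sup>+t. ?f t * indicator {?g 0..?g pi} t \<partial>lborel)"
    using nn_integral_has_integral_lebesgue[OF _ has_integral_Beta_real[OF a a]]
    by (simp add: mult_ac ennreal_mult' ennreal_indicator)
  also have "\<dots> = (\<integral>\<^sup>+\<theta>. ?f (?g \<theta>) * ennreal (sin \<theta> / 2) * indicator {0..pi} \<theta> \<partial>lborel)"
    by (rule nn_integral_substitution_aux)
       (auto intro!: derivative_eq_intros continuous_intros divide_nonneg_nonneg sin_ge_zero)
  also have "\<dots> = (\<integral>\<^sup>+\<theta>. ennreal (2 powr (- 2 * \<alpha>)) * (ennreal (sin \<theta> powr (2 * \<alpha>)) * indicator {0..pi} \<theta>) \<partial>lborel)"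
  proof (rule nn_integral_cong)
    fix \<theta> :: real
    have "?g \<theta> powr (a - 1) * (1 - ?g \<theta>) powr (a - 1) * (sin \<theta> / 2) = 2 powr (- 2 * \<alpha>) * sin \<theta> powr (2 * \<alpha>)"
      if "0 < sin \<theta>"
    proof -
      have "?g \<theta> powr (a - 1) * (1 - ?g \<theta>) powr (a - 1) = (?g \<theta> * (1 - ?g \<theta>)) powr (a - 1)"
        by (simp only: powr_mult)
      also have "?g \<theta> * (1 - ?g \<theta>) = (sin \<theta> / 2)\<^sup>2"
        by (simp add: sin_squared_eq power_divide) (simp add: field_simps power2_eq_square)
      also have "\<dots> = (sin \<theta> / 2) powr 2" using that by simp
      finally have "?g \<theta> powr (a - 1) * (1 - ?g \<theta>) powr (a - 1) * (sin \<theta> / 2)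
          = ((sin \<theta> / 2) powr 2) powr (a - 1) * (sin \<theta> / 2) powr 1"
        using that by (simp only:) simp
      also have "((sin \<theta> / 2) powr 2) powr (a - 1) = (sin \<theta> / 2) powr (2 * a - 2)"
        by (simp only: powr_powr) (simp add: algebra_simps)
      also have "(sin \<theta> / 2) powr (2 * a - 2) * (sin \<theta> / 2) powr 1 = (sin \<theta> / 2) powr (2 * \<alpha>)"
        by (subst powr_add[symmetric]) (simp add: a_def)
      also have "\<dots> = 2 powr (- 2 * \<alpha>) * sin \<theta> powr (2 * \<alpha>)"
        using that by (simp add: powr_divide powr_minus_divide)
      finally show ?thesis .
    qed
    then have "?f (?g \<theta>) * ennreal (sin \<theta> / 2) = ennreal (2 powr (- 2 * \<alpha>)) * ennreal (sin \<theta> powr (2 * \<alpha>))"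
      if "\<theta> \<in> {0..pi}"
      using sin_ge_zero[of \<theta>] that by (cases "sin \<theta> = 0") (auto simp: ennreal_mult[symmetric])
    then show "?f (?g \<theta>) * ennreal (sin \<theta> / 2) * indicator {0..pi} \<theta> =
        ennreal (2 powr (- 2 * \<alpha>)) * (ennreal (sin \<theta> powr (2 * \<alpha>)) * indicator {0..pi} \<theta>)"
      by (cases "\<theta> \<in> {0..pi}") (auto simp: mult.assoc)
  qed
  also have "\<dots> = ennreal (2 powr (- 2 * \<alpha>)) * (\<integral>\<^sup>+\<theta>. ennreal (sin \<theta> powr (2 * \<alpha>)) * indicator {0..pi} \<theta> \<partial>lborel)"
    by (rule nn_integral_cmult) simp
  finally have B: "ennreal (2 powr (2 * \<alpha>)) * ennreal (Beta a a) = (\<integral>\<^sup>+\<theta>. ennreal (sin \<theta> powr (2 * \<alpha>)) * indicator {0..pi} \<theta> \<partial>lborel)"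
    by (simp add: mult.assoc[symmetric] ennreal_mult[symmetric] powr_add[symmetric])
  have "emeasure (angle_measure \<alpha>) UNIV = (\<integral>\<^sup>+\<theta>. ennreal C * (ennreal (sin \<theta> powr (2 * \<alpha>)) * indicator {0..pi} \<theta>) \<partial>lborel)"
    unfolding angle_measure_def
    by (subst emeasure_density)
       (auto intro!: nn_integral_cong simp: C_def[symmetric] angle_density_def indicator_def ennreal_mult C)
  also have "\<dots> = ennreal C * (ennreal (2 powr (2 * \<alpha>)) * ennreal (Beta a a))"
    by (subst nn_integral_cmult) (auto simp: B)
  also have "\<dots> = ennreal (C * (2 powr (2 * \<alpha>) * Beta a a))"
  proof -
    have "0 \<le> Beta a a" unfolding Beta using pos by (intro divide_nonneg_nonneg mult_nonneg_nonneg) auto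
    then show ?thesis using C by (simp add: ennreal_mult)
  qed
  also have "C * (2 powr (2 * \<alpha>) * Beta a a) = 1"
  proof -
    have "Gamma a * Gamma (a + 1 / 2) = exp ((1 - 2 * a) * ln 2) * sqrt pi * Gamma (2 * a)"
    proof -
      have "complex_of_real a \<notin> \<int>\<^sub>\<le>\<^sub>0" "complex_of_real a + 1 / 2 \<notin> \<int>\<^sub>\<le>\<^sub>0"
        using a by (auto elim!: nonpos_Ints_cases simp: complex_eq_iff)
      then have "Gamma (complex_of_real a) * Gamma (complex_of_real (a + 1 / 2)) =
          exp (complex_of_real ((1 - 2 * a) * ln 2)) * of_real (sqrt pi) * Gamma (complex_of_real (2 * a))"
        using Gamma_legendre_duplication[of "complex_of_real a"] by simp
      then have "complex_of_real (Gamma a * Gamma (a + 1 / 2)) =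
          complex_of_real (exp ((1 - 2 * a) * ln 2) * sqrt pi * Gamma (2 * a))"
        by (simp only: Gamma_complex_of_real exp_of_real of_real_mult[symmetric])
      then show ?thesis by (simp only: of_real_eq_iff)
    qed
    also have "exp ((1 - 2 * a) * ln 2) = 1 / 2 powr (2 * \<alpha>)"
      by (simp add: a_def powr_def exp_minus field_simps)
    finally have "Gamma a * Gamma (a + 1 / 2) * 2 powr (2 * \<alpha>) = sqrt pi * Gamma (2 * a)" by simp
    moreover have "C = Gamma (a + 1 / 2) / (Gamma a * sqrt pi)"
    proof -
      have "\<alpha> + 1 = a + 1 / 2" by (simp add: a_def)
      then show ?thesis unfolding C_def angle_const_def a_def[symmetric] by (simp only: Gamma_one_half_real)
    qed
    moreover have "H / (A * S) * (T * (A * A / D)) = 1"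
      if "A * H * T = S * D" "0 < A" "0 < S" "0 < D" for A D H S T :: real
    proof -
      have "H / (A * S) * (T * (A * A / D)) = (A * H * T) / (S * D)" using that(2-) by simp
      also have "\<dots> = 1" unfolding that(1) using that(2-) by simp
      finally show ?thesis .
    qed
    ultimately show ?thesis using pos unfolding Beta by (metis pi_gt_zero real_sqrt_gt_zero)
  qed
  finally show ?thesis by simp
qed

lemma finite_measure_angle_measure: "- 1 / 2 < \<alpha> \<Longrightarrow> finite_measure (angle_measure \<alpha>)"
  by (rule finite_measureI) (simp add: emeasure_angle_measure_UNIV)

text \<open>
  With \<open>u = - \<surd>x cos \<theta>\<close> and \<open>y = x - u\<^sup>2\<close> the argument \<open>x + t + 2 \<surd>(x t) cos \<theta>\<close> becomes
  \<open>y + (u - \<surd>t)\<^sup>2\<close>, and \<open>x\<^sup>\<alpha> sin\<^sup>2\<^sup>\<alpha> \<theta> d\<theta> dx\<close> becomes a product measure in which \<open>u\<close> carries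
  Lebesgue measure. Hence the averages preserve the weighted integral, because a translation
  of \<open>u\<close> does. (For integral \<open>2 \<alpha>\<close> this is the invariance of Lebesgue measure under
  translations, read for radial functions on a space of dimension \<open>2 \<alpha> + 2\<close>.)
\<close>

lemma nn_integral_generalized_translation:
  fixes G :: "real \<Rightarrow> ennreal"
  assumes [measurable]: "G \<in> borel_measurable borel" and \<alpha>: "- 1 / 2 < \<alpha>" and t: "0 \<le> t"
  shows "(\<integral>\<^sup>+x\<in>{0..}. (\<integral>\<^sup>+\<theta>. G (x + t + 2 * sqrt (x * t) * cos \<theta>) \<partial>angle_measure \<alpha>) * ennreal (x powr \<alpha>) \<partial>lborel) =
    (\<integral>\<^sup>+x\<in>{0..}. G x * ennreal (x powr \<alpha>) \<partial>lborel)"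
proof -
  define C where "C = angle_const \<alpha>"
  have C: "0 \<le> C" unfolding C_def using \<alpha> by (rule angle_const_nonneg)
  have density: "angle_density \<alpha> \<theta> = indicator {0..pi} \<theta> * (C * sin \<theta> powr (2 * \<alpha>))" for \<theta>
    by (simp only: angle_density_def C_def)
  interpret finite_measure "angle_measure \<alpha>" by (rule finite_measure_angle_measure[OF \<alpha>])
  define w where "w y = ennreal (y powr (\<alpha> - 1 / 2)) * indicator {0..} y" for y :: real
  have [measurable]: "w \<in> borel_measurable borel" unfolding w_def[abs_def] by measurable
  \<comment> \<open>the inner integral in the coordinates \<open>(u, y)\<close>, where the parameter is a shift of \<open>u\<close>\<close>
  define H where "H u = (\<integral>\<^sup>+y. G (y + u\<^sup>2) * w y \<partial>lborel)" for u :: real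
  have [measurable]: "H \<in> borel_measurable borel" unfolding H_def[abs_def] by measurable
  have J: "(\<integral>\<^sup>+x\<in>{0..}. (\<integral>\<^sup>+\<theta>. G (x + s + 2 * sqrt (x * s) * cos \<theta>) \<partial>angle_measure \<alpha>) * ennreal (x powr \<alpha>) \<partial>lborel)
     = ennreal C * (\<integral>\<^sup>+u. H u \<partial>lborel)" if s: "0 \<le> s" for s
  proof -
    have inner: "(\<integral>\<^sup>+\<theta>. G (x + s + 2 * sqrt (x * s) * cos \<theta>) \<partial>angle_measure \<alpha>) * ennreal (x powr \<alpha>) * indicator {0..} x
        = ennreal C * (\<integral>\<^sup>+u. G (x + s - 2 * sqrt s * u) * w (x - u\<^sup>2) \<partial>lborel)" for x :: real
    proof (cases "0 < x")
      case False
      then have "x - u\<^sup>2 \<le> 0" for u using zero_le_power2[of u] by linarith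
      moreover have "w y = 0" if "y \<le> 0" for y
        using that by (cases "y = 0") (auto simp: w_def)
      ultimately have "w (x - u\<^sup>2) = 0" for u by blast
      then show ?thesis using False by (auto simp: indicator_def)
    next
      case True
      have u: "u\<^sup>2 \<le> x \<longleftrightarrow> - sqrt x \<le> u \<and> u \<le> sqrt x" for u
        by (metis abs_le_iff minus_le_iff real_sqrt_abs real_sqrt_le_iff)
      have "(\<integral>\<^sup>+\<theta>. G (x + s + 2 * sqrt (x * s) * cos \<theta>) \<partial>angle_measure \<alpha>) * ennreal (x powr \<alpha>) * indicator {0..} x
          = (\<integral>\<^sup>+\<theta>. ennreal (x powr \<alpha>) * (ennreal (angle_density \<alpha> \<theta>) * G (x + s + 2 * sqrt (x * s) * cos \<theta>)) \<partial>lborel)"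
        using True unfolding angle_measure_def
        by (subst nn_integral_density) (auto simp: nn_integral_cmult mult.commute)
      also have "\<dots> = (\<integral>\<^sup>+\<theta>. ennreal C * (G (x + s - 2 * sqrt s * (- (sqrt x * cos \<theta>))) *
            ennreal (x powr \<alpha> * sin \<theta> powr (2 * \<alpha>)) * indicator {0..pi} \<theta>) \<partial>lborel)"
        using C by (intro nn_integral_cong)
          (auto simp: density indicator_def ennreal_mult real_sqrt_mult ac_simps)
      also have "\<dots> = ennreal C * (\<integral>\<^sup>+\<theta>. G (x + s - 2 * sqrt s * (- (sqrt x * cos \<theta>))) *
            ennreal (x powr \<alpha> * sin \<theta> powr (2 * \<alpha>)) * indicator {0..pi} \<theta> \<partial>lborel)"
        by (rule nn_integral_cmult) measurable
      also have "(\<integral>\<^sup>+\<theta>. G (x + s - 2 * sqrt s * (- (sqrt x * cos \<theta>))) *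
            ennreal (x powr \<alpha> * sin \<theta> powr (2 * \<alpha>)) * indicator {0..pi} \<theta> \<partial>lborel) =
          (\<integral>\<^sup>+u. G (x + s - 2 * sqrt s * u) * ennreal ((x - u\<^sup>2) powr (\<alpha> - 1 / 2)) * indicator {- sqrt x..sqrt x} u \<partial>lborel)"
        by (rule nn_integral_cos_substitution[OF _ True, where \<phi> = "\<lambda>u. G (x + s - 2 * sqrt s * u)"]) measurable
      also have "\<dots> = (\<integral>\<^sup>+u. G (x + s - 2 * sqrt s * u) * w (x - u\<^sup>2) \<partial>lborel)"
        by (intro nn_integral_cong) (auto simp: w_def indicator_def u mult.assoc)
      finally show ?thesis .
    qed
    have "(\<integral>\<^sup>+x. \<integral>\<^sup>+u. G (x + s - 2 * sqrt s * u) * w (x - u\<^sup>2) \<partial>lborel \<partial>lborel) =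
        (\<integral>\<^sup>+u. \<integral>\<^sup>+x. G (x + s - 2 * sqrt s * u) * w (x - u\<^sup>2) \<partial>lborel \<partial>lborel)"
      by (rule lborel_pair.Fubini'[symmetric]) measurable
    also have "\<dots> = (\<integral>\<^sup>+u. H (u - sqrt s) \<partial>lborel)"
    proof (rule nn_integral_cong)
      fix u
      have "(\<integral>\<^sup>+x. G (x + s - 2 * sqrt s * u) * w (x - u\<^sup>2) \<partial>lborel) =
          (\<integral>\<^sup>+y. G (u\<^sup>2 + y + s - 2 * sqrt s * u) * w y \<partial>lborel)"
        by (subst nn_integral_real_affine[where c = 1 and t = "u\<^sup>2"]) auto
      also have "\<dots> = H (u - sqrt s)"
        using s unfolding H_def by (simp add: power2_diff algebra_simps)
      finally show "(\<integral>\<^sup>+x. G (x + s - 2 * sqrt s * u) * w (x - u\<^sup>2) \<partial>lborel) = H (u - sqrt s)" .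
    qed
    also have "\<dots> = (\<integral>\<^sup>+u. H u \<partial>lborel)"
      by (subst nn_integral_real_affine[where c = 1 and t = "sqrt s"]) auto
    finally show ?thesis
      by (simp add: inner nn_integral_cmult)
  qed
  \<comment> \<open>the shift by zero identifies the common value\<close>
  have "ennreal C * (\<integral>\<^sup>+u. H u \<partial>lborel) = (\<integral>\<^sup>+x\<in>{0..}. G x * ennreal (x powr \<alpha>) \<partial>lborel)"
    using J[of 0] by (simp add: emeasure_angle_measure_UNIV[OF \<alpha>])
  then show ?thesis using J[OF t] by simp
qed

section \<open>Jensen's inequality for powers\<close>

text \<open>
  Stated with a bound \<open>c\<close> in place of a power of the integral, so that it applies to
  extended nonnegative integrals without taking roots of them.
\<close>

lemma nn_integral_le_of_powr:
  fixes u :: "'a \<Rightarrow> real"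
  assumes p: "1 \<le> p" and M: "emeasure M (space M) \<le> 1" and [measurable]: "u \<in> borel_measurable M"
    and u: "\<And>x. 0 \<le> u x" and c: "0 \<le> c"
    and le: "(\<integral>\<^sup>+x. ennreal (u x powr p) \<partial>M) \<le> ennreal (c powr p)"
  shows "(\<integral>\<^sup>+x. ennreal (u x) \<partial>M) \<le> ennreal c"
proof (rule ennreal_le_epsilon)
  fix e :: real assume "0 < e"
  \<comment> \<open>the tangent below needs a positive base point, and \<open>c\<close> may vanish\<close>
  define d where "d = c + e"
  have d: "0 < d" using c \<open>0 < e\<close> by (simp add: d_def)
  \<comment> \<open>the tangent of the convex function \<open>w \<mapsto> w\<^sup>p\<close> at \<open>d\<close>\<close>
  have tangent: "w \<le> (1 - 1 / p) * d + d / (p * d powr p) * w powr p" if "0 \<le> w" for w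
  proof (cases "w = 0")
    case True then show ?thesis using p d by simp
  next
    case False
    then have w: "0 < w" using that by simp
    have "((w / d) powr p) powr (1 / p) * 1 powr (1 - 1 / p) \<le> 1 / p * (w / d) powr p + (1 - 1 / p) * 1"
      using p w d by (intro Youngs_inequality_0) auto
    then have "w / d \<le> 1 / p * (w powr p / d powr p) + (1 - 1 / p)"
      using p w d by (simp add: powr_powr powr_divide)
    then have "w / d * d \<le> (1 / p * (w powr p / d powr p) + (1 - 1 / p)) * d"
      using d by (intro mult_right_mono) auto
    then show ?thesis using d by (simp add: algebra_simps)
  qed
  have "(\<integral>\<^sup>+x. ennreal (u x) \<partial>M) \<le>
      (\<integral>\<^sup>+x. ennreal ((1 - 1 / p) * d) + ennreal (d / (p * d powr p)) * ennreal (u x powr p) \<partial>M)"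
    using tangent[OF u] p d
    by (intro nn_integral_mono) (simp add: ennreal_mult[symmetric] ennreal_plus[symmetric] del: ennreal_plus)
  also have "\<dots> = ennreal ((1 - 1 / p) * d) * emeasure M (space M) +
      ennreal (d / (p * d powr p)) * (\<integral>\<^sup>+x. ennreal (u x powr p) \<partial>M)"
    by (simp add: nn_integral_add nn_integral_cmult)
  also have "\<dots> \<le> ennreal ((1 - 1 / p) * d) * 1 + ennreal (d / (p * d powr p)) * ennreal (d powr p)"
  proof (intro add_mono mult_left_mono M)
    have "c powr p \<le> d powr p" using p c \<open>0 < e\<close> by (intro powr_mono2) (auto simp: d_def)
    then show "(\<integral>\<^sup>+x. ennreal (u x powr p) \<partial>M) \<le> ennreal (d powr p)"
      using le by (auto intro: order_trans ennreal_leI)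
  qed auto
  also have "\<dots> = ennreal ((1 - 1 / p) * d + d / (p * d powr p) * d powr p)"
    using p d by (simp add: ennreal_mult[symmetric] ennreal_plus[symmetric] del: ennreal_plus)
  also have "(1 - 1 / p) * d + d / (p * d powr p) * d powr p = c + e"
    using p d by (simp add: field_simps d_def)
  finally show "(\<integral>\<^sup>+x. ennreal (u x) \<partial>M) \<le> ennreal c + ennreal e"
    using c \<open>0 < e\<close> by simp
qed

lemma integral_powr_le:
  fixes v :: "'a \<Rightarrow> real"
  assumes p: "1 \<le> p" and M: "emeasure M (space M) \<le> 1" and [measurable]: "v \<in> borel_measurable M"
  shows "ennreal (\<bar>integral\<^sup>L M v\<bar> powr p) \<le> (\<integral>\<^sup>+x. ennreal (\<bar>v x\<bar> powr p) \<partial>M)"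
proof (cases "\<integral>\<^sup>+x. ennreal (\<bar>v x\<bar> powr p) \<partial>M")
  case (real r)
  define c where "c = r powr (1 / p)"
  have cp: "c powr p = r" using p real by (simp add: c_def powr_powr)
  have "ennreal \<bar>integral\<^sup>L M v\<bar> \<le> (\<integral>\<^sup>+x. ennreal \<bar>v x\<bar> \<partial>M)"
    using integral_norm_bound_ennreal[of M v]
    by (cases "integrable M v") (simp_all add: not_integrable_integral_eq)
  also have "\<dots> \<le> ennreal c"
  proof (rule nn_integral_le_of_powr[OF p M])
    show "(\<integral>\<^sup>+x. ennreal (\<bar>v x\<bar> powr p) \<partial>M) \<le> ennreal (c powr p)"
      using real by (simp only: cp order.refl)
  qed (simp_all add: c_def)
  finally have "ennreal \<bar>integral\<^sup>L M v\<bar> \<le> ennreal c" .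
  then have "\<bar>integral\<^sup>L M v\<bar> \<le> c" by (subst (asm) ennreal_le_iff) (simp_all add: c_def)
  then have "\<bar>integral\<^sup>L M v\<bar> powr p \<le> r"
    using p cp powr_mono2[of p "\<bar>integral\<^sup>L M v\<bar>" c] by simp
  then show ?thesis using real by (simp add: ennreal_leI)
qed (simp add: top_unique)

lemma integrable_of_powr:
  fixes v :: "'a \<Rightarrow> real"
  assumes p: "1 \<le> p" and M: "emeasure M (space M) \<le> 1" and [measurable]: "v \<in> borel_measurable M"
    and fin: "(\<integral>\<^sup>+x. ennreal (\<bar>v x\<bar> powr p) \<partial>M) < \<infinity>"
  shows "integrable M v"
proof -
  obtain r where r: "0 \<le> r" "(\<integral>\<^sup>+x. ennreal (\<bar>v x\<bar> powr p) \<partial>M) = ennreal r"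
    using fin by (cases "\<integral>\<^sup>+x. ennreal (\<bar>v x\<bar> powr p) \<partial>M") auto
  have "(\<integral>\<^sup>+x. ennreal \<bar>v x\<bar> \<partial>M) \<le> ennreal (r powr (1 / p))"
  proof (rule nn_integral_le_of_powr[OF p M])
    show "(\<integral>\<^sup>+x. ennreal (\<bar>v x\<bar> powr p) \<partial>M) \<le> ennreal ((r powr (1 / p)) powr p)"
      using r p by (simp add: powr_powr)
  qed simp_all
  also have "\<dots> < \<infinity>" by simp
  finally show ?thesis by (intro integrableI_bounded) auto
qed

section \<open>The Laguerre norm\<close>

lemma set_borel_measurableI:
  fixes f :: "real \<Rightarrow> real"
  assumes [measurable]: "f \<in> borel_measurable borel" "A \<in> sets borel"
  shows "set_borel_measurable lborel A f"
  unfolding set_borel_measurable_def by measurable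

lemma laguerre_norm_cong_AE:
  assumes "AE x in lborel. x \<in> A \<longrightarrow> f x = g x"
  shows "laguerre_norm p \<alpha> A f = laguerre_norm p \<alpha> A g"
proof -
  have "(\<integral>\<^sup>+x\<in>A. ennreal (\<bar>f x * exp (- x / 2)\<bar> powr p * x powr \<alpha>) \<partial>lborel) =
      (\<integral>\<^sup>+x\<in>A. ennreal (\<bar>g x * exp (- x / 2)\<bar> powr p * x powr \<alpha>) \<partial>lborel)"
    by (rule nn_integral_cong_AE) (use assms in \<open>eventually_elim, auto simp: indicator_def\<close>)
  then show ?thesis by (simp add: laguerre_norm_def)
qed

lemma laguerre_norm_cong:
  "(\<And>x. x \<in> A \<Longrightarrow> f x = g x) \<Longrightarrow> laguerre_norm p \<alpha> A f = laguerre_norm p \<alpha> A g"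
  by (rule laguerre_norm_cong_AE) simp

lemma laguerre_norm_mono:
  assumes "1 \<le> p" and "\<And>x. x \<in> A \<Longrightarrow> x \<in> B \<and> \<bar>f x\<bar> \<le> \<bar>g x\<bar>"
  shows "laguerre_norm p \<alpha> A f \<le> laguerre_norm p \<alpha> B g"
proof (cases "laguerre_norm p \<alpha> B g")
  case (real c)
  have "(\<integral>\<^sup>+x\<in>A. ennreal (\<bar>f x * exp (- x / 2)\<bar> powr p * x powr \<alpha>) \<partial>lborel) \<le>
      (\<integral>\<^sup>+x\<in>B. ennreal (\<bar>g x * exp (- x / 2)\<bar> powr p * x powr \<alpha>) \<partial>lborel)"
    using assms
    by (intro nn_integral_mono)
       (auto simp: indicator_def abs_mult intro!: ennreal_leI mult_right_mono powr_mono2)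
  also have "\<dots> \<le> ennreal (c powr p)"
    using real laguerre_norm_le_iff[OF assms(1), of c \<alpha> B g] by simp
  finally show ?thesis using real laguerre_norm_le_iff[OF assms(1), of c \<alpha> A f] by simp
qed simp

lemma laguerre_norm_le_of_bounded_support:
  assumes p: "1 \<le> p" and \<alpha>: "0 \<le> \<alpha>" and B: "0 \<le> B" and R: "0 \<le> R"
    and bound: "\<And>x. 0 \<le> x \<Longrightarrow> x \<le> R \<Longrightarrow> \<bar>f x\<bar> \<le> B" and supp: "\<And>x. R < x \<Longrightarrow> f x = 0"
  shows "laguerre_norm p \<alpha> {0..} f \<le> ennreal (B * (R powr \<alpha> * R) powr (1 / p))"
proof -
  have "(\<integral>\<^sup>+x\<in>{0..}. ennreal (\<bar>f x * exp (- x / 2)\<bar> powr p * x powr \<alpha>) \<partial>lborel) \<le>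
      (\<integral>\<^sup>+x. ennreal (B powr p * R powr \<alpha>) * indicator {0..R} x \<partial>lborel)"
  proof (rule nn_integral_mono)
    fix x :: real
    have "\<bar>f x * exp (- x / 2)\<bar> powr p * x powr \<alpha> \<le> B powr p * R powr \<alpha>" if "0 \<le> x" "x \<le> R"
    proof -
      have "\<bar>f x * exp (- x / 2)\<bar> \<le> B * 1"
        unfolding abs_mult using bound that B by (intro mult_mono) auto
      then show ?thesis using that p \<alpha> by (intro mult_mono powr_mono2) auto
    qed
    then show "ennreal (\<bar>f x * exp (- x / 2)\<bar> powr p * x powr \<alpha>) * indicator {0..} x \<le>
        ennreal (B powr p * R powr \<alpha>) * indicator {0..R} x"
      using supp[of x] p by (auto simp: indicator_def intro: ennreal_leI)
  qed
  also have "\<dots> = ennreal ((B * (R powr \<alpha> * R) powr (1 / p)) powr p)"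
    using B R p by (simp add: nn_integral_cmult ennreal_mult[symmetric] powr_mult powr_powr mult.assoc)
  finally show ?thesis using p B by (subst laguerre_norm_le_iff) auto
qed

text \<open>
  One dominated convergence argument serves three purposes: truncating a function, approximating
  a truncated function by continuous ones, and making the tail of a single function small.
\<close>

lemma laguerre_norm_dominated_convergence:
  assumes p: "1 \<le> p" and [measurable]: "\<And>n. u n \<in> borel_measurable borel" "w \<in> borel_measurable borel"
    and bound: "\<And>n x. 0 \<le> x \<Longrightarrow> \<bar>u n x\<bar> \<le> \<bar>w x\<bar>" and w: "laguerre_norm p \<alpha> {0..} w < \<infinity>"
    and lim: "AE x in lborel. 0 \<le> x \<longrightarrow> (\<lambda>n. u n x) \<longlonglongrightarrow> 0" and e: "0 < e"
  shows "\<exists>n::nat. laguerre_norm p \<alpha> {0..} (u n) \<le> ennreal e"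
proof -
  let ?i = "\<lambda>f x. ennreal (\<bar>f x * exp (- x / 2)\<bar> powr p * x powr \<alpha>) * indicator {0..} x"
  obtain c where c: "0 \<le> c" "laguerre_norm p \<alpha> {0..} w = ennreal c"
    using w by (cases "laguerre_norm p \<alpha> {0..} w") auto
  have "(\<integral>\<^sup>+x. ?i w x \<partial>lborel) \<le> ennreal (c powr p)"
    using laguerre_norm_le_iff[OF p c(1), of \<alpha> "{0..}" w] c by simp
  then have fin: "(\<integral>\<^sup>+x. ?i w x \<partial>lborel) < \<infinity>" by (rule le_less_trans) simp
  have "(\<lambda>n. \<integral>\<^sup>+x. ?i (u n) x \<partial>lborel) \<longlonglongrightarrow> (\<integral>\<^sup>+(x::real). 0 \<partial>lborel)"
  proof (rule nn_integral_dominated_convergence[where u = "\<lambda>n. ?i (u n)" and u' = "\<lambda>_. 0" and w = "?i w"])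
    show "(\<integral>\<^sup>+x. ?i w x \<partial>lborel) < \<infinity>" by (rule fin)
    show "AE x in lborel. ?i (u n) x \<le> ?i w x" for n
      using bound p
      by (intro AE_I2) (auto simp: indicator_def abs_mult intro!: ennreal_leI mult_right_mono powr_mono2)
    show "AE x in lborel. (\<lambda>n. ?i (u n) x) \<longlonglongrightarrow> 0"
      using lim
    proof eventually_elim
      case (elim x)
      show ?case
      proof (cases "0 \<le> x")
        case True
        have "(\<lambda>n. \<bar>u n x * exp (- x / 2)\<bar>) \<longlonglongrightarrow> \<bar>0 * exp (- x / 2)\<bar>"
          using elim True by (intro tendsto_intros) auto
        then have "(\<lambda>n. \<bar>u n x * exp (- x / 2)\<bar> powr p) \<longlonglongrightarrow> 0 powr p"
          using p by (intro tendsto_powr') auto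
        then have "(\<lambda>n. ennreal (\<bar>u n x * exp (- x / 2)\<bar> powr p * x powr \<alpha>)) \<longlonglongrightarrow> ennreal (0 * x powr \<alpha>)"
          using p by (intro tendsto_ennrealI tendsto_intros) auto
        then show ?thesis using True by simp
      qed simp
    qed
  qed auto
  moreover have "0 < ennreal (e powr p)" using e by simp
  ultimately have "\<forall>\<^sub>F n in sequentially. (\<integral>\<^sup>+x. ?i (u n) x \<partial>lborel) < ennreal (e powr p)"
    by (intro order_tendstoD(2)) auto
  then obtain n where "(\<integral>\<^sup>+x. ?i (u n) x \<partial>lborel) < ennreal (e powr p)"
    using eventually_happens'[OF sequentially_bot] by blast
  then have "laguerre_norm p \<alpha> {0..} (u n) \<le> ennreal e"
    using e by (subst laguerre_norm_le_iff[OF p]) auto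
  then show ?thesis ..
qed

section \<open>The translation is bounded\<close>

definition translation_integrand :: "real \<Rightarrow> (real \<Rightarrow> real) \<Rightarrow> real \<Rightarrow> real \<Rightarrow> real \<Rightarrow> real" where
  "translation_integrand \<alpha> f t x \<theta> =
     f (x + t + 2 * sqrt (x * t) * cos \<theta>) * exp (- (sqrt (x * t) * cos \<theta>)) *
     bessel_j (\<alpha> - 1 / 2) (sqrt (x * t) * sin \<theta>)"

lemma borel_measurable_bessel_j [measurable]: "- 1 / 2 < \<alpha> \<Longrightarrow> bessel_j (\<alpha> - 1 / 2) \<in> borel_measurable borel"
  by (intro borel_measurable_continuous_onI continuous_on_bessel_j) (auto intro: continuous_intros)

lemma borel_measurable_translation_integrand:
  assumes \<alpha>: "- 1 / 2 < \<alpha>" and [measurable]: "f \<in> borel_measurable borel"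
  shows "(\<lambda>((t, x), \<theta>). translation_integrand \<alpha> f t x \<theta>) \<in> borel_measurable ((borel \<Otimes>\<^sub>M borel) \<Otimes>\<^sub>M borel)"
proof -
  have [measurable]: "bessel_j (\<alpha> - 1 / 2) \<in> borel_measurable borel"
    using \<alpha> by (rule borel_measurable_bessel_j)
  show ?thesis unfolding translation_integrand_def split_beta' by measurable
qed

lemma borel_measurable_translation_integrand_angle:
  assumes "- 1 / 2 < \<alpha>" and "f \<in> borel_measurable borel"
  shows "translation_integrand \<alpha> f t x \<in> borel_measurable borel"
  using measurable_compose[OF _ borel_measurable_translation_integrand[OF assms], of "\<lambda>\<theta>. ((t, x), \<theta>)" borel]
  by simp

lemma laguerre_translation_eq_integral:
  assumes \<alpha>: "- 1 / 2 < \<alpha>" and f: "f \<in> borel_measurable borel"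
  shows "laguerre_translation \<alpha> t f x = (\<integral>\<theta>. translation_integrand \<alpha> f t x \<theta> \<partial>angle_measure \<alpha>)"
proof -
  have "(\<integral>\<theta>. translation_integrand \<alpha> f t x \<theta> \<partial>angle_measure \<alpha>)
      = (\<integral>\<theta>. angle_density \<alpha> \<theta> * translation_integrand \<alpha> f t x \<theta> \<partial>lborel)"
    unfolding angle_measure_def
    using borel_measurable_translation_integrand_angle[OF \<alpha> f] angle_density_nonneg[OF \<alpha>]
    by (subst integral_density) auto
  also have "\<dots> = laguerre_translation \<alpha> t f x"
    unfolding laguerre_translation_def set_lebesgue_integral_def
    by (subst integral_mult_right_zero[symmetric])
       (auto intro!: Bochner_Integration.integral_cong simp: angle_density_def angle_const_def translation_integrand_def mult_ac)
  finally show ?thesis ..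
qed

lemma borel_measurable_laguerre_translation:
  assumes \<alpha>: "- 1 / 2 < \<alpha>" and f: "f \<in> borel_measurable borel"
  shows "(\<lambda>(t, x). laguerre_translation \<alpha> t f x) \<in> borel_measurable (borel \<Otimes>\<^sub>M borel)"
proof -
  interpret finite_measure "angle_measure \<alpha>" by (rule finite_measure_angle_measure[OF \<alpha>])
  have "(\<lambda>z. \<integral>\<theta>. translation_integrand \<alpha> f (fst z) (snd z) \<theta> \<partial>angle_measure \<alpha>) \<in> borel_measurable (borel \<Otimes>\<^sub>M borel)"
    using borel_measurable_translation_integrand[OF \<alpha> f]
    by (intro borel_measurable_lebesgue_integral) (simp add: split_beta' cong: measurable_cong_sets sets_pair_measure_cong)
  then show ?thesis by (simp add: laguerre_translation_eq_integral[OF \<alpha> f] split_beta')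
qed

lemma borel_measurable_laguerre_translation_right:
  assumes \<alpha>: "- 1 / 2 < \<alpha>" and f: "f \<in> borel_measurable borel"
  shows "laguerre_translation \<alpha> t f \<in> borel_measurable borel"
  using measurable_compose[OF _ borel_measurable_laguerre_translation[OF assms], of "\<lambda>x. (t, x)" borel] by simp

lemma laguerre_translation_commute: "laguerre_translation \<alpha> t f x = laguerre_translation \<alpha> x f t"
  by (simp add: laguerre_translation_def mult.commute add.commute)

lemma laguerre_translation_0:
  assumes \<alpha>: "- 1 / 2 < \<alpha>" and f: "f \<in> borel_measurable borel"
  shows "laguerre_translation \<alpha> 0 f x = f x"
proof -
  interpret finite_measure "angle_measure \<alpha>" by (rule finite_measure_angle_measure[OF \<alpha>])
  have "bessel_j (\<alpha> - 1 / 2) 0 = 1" using \<alpha> by (intro bessel_j_0) simp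
  then show ?thesis
    by (simp add: laguerre_translation_eq_integral[OF assms] translation_integrand_def
        measure_def emeasure_angle_measure_UNIV[OF \<alpha>])
qed

lemma translation_argument_nonneg:
  fixes x t \<theta> :: real
  assumes "0 \<le> x" "0 \<le> t"
  shows "0 \<le> x + t + 2 * sqrt (x * t) * cos \<theta>"
proof -
  have "- sqrt (x * t) \<le> sqrt (x * t) * cos \<theta>"
    using assms mult_left_mono[of "- 1" "cos \<theta>" "sqrt (x * t)"] by simp
  moreover have "0 \<le> x + t - 2 * sqrt (x * t)"
    using assms zero_le_power2[of "sqrt x - sqrt t"] by (simp add: power2_diff real_sqrt_mult)
  ultimately show ?thesis by linarith
qed

text \<open>
  The exponentials combine: \<open>exp (- \<surd>(x t) cos \<theta>) exp (- x / 2) = exp (t / 2) exp (- z / 2)\<close>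
  for \<open>z = x + t + 2 \<surd>(x t) cos \<theta>\<close>. This and the bound by one of the Bessel factor, for which
  \<open>\<alpha> \<ge> 0\<close> is needed, compare the translation with the plain average of \<open>f(z) exp (- z / 2)\<close>.
\<close>

lemma translation_integrand_abs_le:
  assumes "0 \<le> \<alpha>"
  shows "\<bar>translation_integrand \<alpha> f t x \<theta> * exp (- x / 2)\<bar> \<le>
    exp (t / 2) * \<bar>f (x + t + 2 * sqrt (x * t) * cos \<theta>) * exp (- (x + t + 2 * sqrt (x * t) * cos \<theta>) / 2)\<bar>"
proof -
  define z s where "z = x + t + 2 * sqrt (x * t) * cos \<theta>" and "s = sqrt (x * t) * cos \<theta>"
  have "exp (- s) * exp (- x / 2) = exp (t / 2) * exp (- z / 2)"
    by (simp add: exp_add[symmetric] s_def z_def field_simps)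
  moreover have "translation_integrand \<alpha> f t x \<theta> * exp (- x / 2) =
      f z * (exp (- s) * exp (- x / 2)) * bessel_j (\<alpha> - 1 / 2) (sqrt (x * t) * sin \<theta>)"
    by (simp add: translation_integrand_def z_def s_def)
  ultimately have "\<bar>translation_integrand \<alpha> f t x \<theta> * exp (- x / 2)\<bar> =
      exp (t / 2) * \<bar>f z * exp (- z / 2)\<bar> * \<bar>bessel_j (\<alpha> - 1 / 2) (sqrt (x * t) * sin \<theta>)\<bar>"
    by (simp only: abs_mult abs_exp_cancel mult_ac)
  also have "\<dots> \<le> exp (t / 2) * \<bar>f z * exp (- z / 2)\<bar> * 1"
    using assms by (intro mult_left_mono bessel_j_abs_le_1) auto
  finally show ?thesis by (simp add: z_def)
qed

lemma nn_integral_translation_integrand_le: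
  assumes p: "1 \<le> p" and \<alpha>: "0 \<le> \<alpha>" and t: "0 \<le> t" and [measurable]: "f \<in> borel_measurable borel"
    and c: "0 \<le> c" "laguerre_norm p \<alpha> {0..} f \<le> ennreal c"
  shows "(\<integral>\<^sup>+x\<in>{0..}. (\<integral>\<^sup>+\<theta>. ennreal (\<bar>translation_integrand \<alpha> f t x \<theta> * exp (- x / 2)\<bar> powr p) \<partial>angle_measure \<alpha>) *
      ennreal (x powr \<alpha>) \<partial>lborel) \<le> ennreal ((exp (t / 2) * c) powr p)"
proof -
  define G where "G z = ennreal (exp (t / 2) powr p * \<bar>f z * exp (- z / 2)\<bar> powr p)" for z
  have [measurable]: "G \<in> borel_measurable borel" unfolding G_def[abs_def] by measurable
  have "(\<integral>\<^sup>+x\<in>{0..}. (\<integral>\<^sup>+\<theta>. ennreal (\<bar>translation_integrand \<alpha> f t x \<theta> * exp (- x / 2)\<bar> powr p) \<partial>angle_measure \<alpha>) *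
      ennreal (x powr \<alpha>) \<partial>lborel) \<le>
      (\<integral>\<^sup>+x\<in>{0..}. (\<integral>\<^sup>+\<theta>. G (x + t + 2 * sqrt (x * t) * cos \<theta>) \<partial>angle_measure \<alpha>) * ennreal (x powr \<alpha>) \<partial>lborel)"
  proof (intro nn_integral_mono mult_right_mono)
    fix x \<theta>
    let ?z = "x + t + 2 * sqrt (x * t) * cos \<theta>"
    have "\<bar>translation_integrand \<alpha> f t x \<theta> * exp (- x / 2)\<bar> powr p \<le> (exp (t / 2) * \<bar>f ?z * exp (- ?z / 2)\<bar>) powr p"
      using p by (intro powr_mono2 translation_integrand_abs_le[OF \<alpha>]) auto
    also have "\<dots> = exp (t / 2) powr p * \<bar>f ?z * exp (- ?z / 2)\<bar> powr p"
      by (rule powr_mult)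
    finally show "ennreal (\<bar>translation_integrand \<alpha> f t x \<theta> * exp (- x / 2)\<bar> powr p) \<le> G ?z"
      unfolding G_def by (rule ennreal_leI)
  qed auto
  also have "\<dots> = (\<integral>\<^sup>+x\<in>{0..}. G x * ennreal (x powr \<alpha>) \<partial>lborel)"
    using \<alpha> t by (intro nn_integral_generalized_translation) auto
  also have "\<dots> = (\<integral>\<^sup>+x. ennreal (exp (t / 2) powr p) *
      (ennreal (\<bar>f x * exp (- x / 2)\<bar> powr p * x powr \<alpha>) * indicator {0..} x) \<partial>lborel)"
    by (intro nn_integral_cong) (simp add: G_def ennreal_mult mult.assoc)
  also have "\<dots> = ennreal (exp (t / 2) powr p) *
      (\<integral>\<^sup>+x\<in>{0..}. ennreal (\<bar>f x * exp (- x / 2)\<bar> powr p * x powr \<alpha>) \<partial>lborel)"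
    by (intro nn_integral_cmult) measurable
  also have "\<dots> \<le> ennreal (exp (t / 2) powr p) * ennreal (c powr p)"
    using c laguerre_norm_le_iff[OF p c(1)] by (intro mult_left_mono) auto
  also have "\<dots> = ennreal ((exp (t / 2) * c) powr p)"
    by (simp only: powr_mult ennreal_mult powr_ge_zero)
  finally show ?thesis .
qed

text \<open>
  The integral over \<open>\<theta>\<close> is an average against a probability measure, so Jensen's inequality
  moves the power inside, and the previous bound applies.
\<close>

lemma laguerre_translation_norm_le:
  assumes p: "1 \<le> p" and \<alpha>: "0 \<le> \<alpha>" and t: "0 \<le> t" and f: "f \<in> borel_measurable borel"
    and c: "0 \<le> c" "laguerre_norm p \<alpha> {0..} f \<le> ennreal c"
  shows "laguerre_norm p \<alpha> {0..} (laguerre_translation \<alpha> t f) \<le> ennreal (exp (t / 2) * c)"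
proof -
  have \<alpha>': "- 1 / 2 < \<alpha>" using \<alpha> by simp
  note [measurable] = borel_measurable_translation_integrand_angle[OF \<alpha>' f]
  have "(\<integral>\<^sup>+x\<in>{0..}. ennreal (\<bar>laguerre_translation \<alpha> t f x * exp (- x / 2)\<bar> powr p * x powr \<alpha>) \<partial>lborel) \<le>
     (\<integral>\<^sup>+x\<in>{0..}. (\<integral>\<^sup>+\<theta>. ennreal (\<bar>translation_integrand \<alpha> f t x \<theta> * exp (- x / 2)\<bar> powr p) \<partial>angle_measure \<alpha>) *
        ennreal (x powr \<alpha>) \<partial>lborel)"
  proof (intro nn_integral_mono mult_right_mono)
    fix x
    have "ennreal (\<bar>laguerre_translation \<alpha> t f x * exp (- x / 2)\<bar> powr p) \<le>
        (\<integral>\<^sup>+\<theta>. ennreal (\<bar>translation_integrand \<alpha> f t x \<theta> * exp (- x / 2)\<bar> powr p) \<partial>angle_measure \<alpha>)"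
      using integral_powr_le[OF p, of "angle_measure \<alpha>" "\<lambda>\<theta>. translation_integrand \<alpha> f t x \<theta> * exp (- x / 2)"]
      by (simp add: emeasure_angle_measure_UNIV[OF \<alpha>'] laguerre_translation_eq_integral[OF \<alpha>' f])
    then have "ennreal (\<bar>laguerre_translation \<alpha> t f x * exp (- x / 2)\<bar> powr p) * ennreal (x powr \<alpha>) \<le>
        (\<integral>\<^sup>+\<theta>. ennreal (\<bar>translation_integrand \<alpha> f t x \<theta> * exp (- x / 2)\<bar> powr p) \<partial>angle_measure \<alpha>) * ennreal (x powr \<alpha>)"
      by (rule mult_right_mono) simp
    then show "ennreal (\<bar>laguerre_translation \<alpha> t f x * exp (- x / 2)\<bar> powr p * x powr \<alpha>) \<le>
        (\<integral>\<^sup>+\<theta>. ennreal (\<bar>translation_integrand \<alpha> f t x \<theta> * exp (- x / 2)\<bar> powr p) \<partial>angle_measure \<alpha>) * ennreal (x powr \<alpha>)"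
      by (simp only: ennreal_mult powr_ge_zero)
  qed auto
  also have "\<dots> \<le> ennreal ((exp (t / 2) * c) powr p)"
    by (rule nn_integral_translation_integrand_le[OF assms])
  finally show ?thesis using c by (subst laguerre_norm_le_iff[OF p]) auto
qed

text \<open>
  The averages of the \<open>p\<close>-th powers have a finite integral over \<open>x\<close>, hence are finite almost
  everywhere; against a finite measure this gives integrability.
\<close>

lemma AE_integrable_translation_integrand:
  assumes p: "1 \<le> p" and \<alpha>: "0 \<le> \<alpha>" and t: "0 \<le> t" and f: "f \<in> borel_measurable borel"
    and fin: "laguerre_norm p \<alpha> {0..} f < \<infinity>"
  shows "AE x in lborel. 0 \<le> x \<longrightarrow> integrable (angle_measure \<alpha>) (translation_integrand \<alpha> f t x)"
proof -
  have \<alpha>': "- 1 / 2 < \<alpha>" using \<alpha> by simp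
  interpret finite_measure "angle_measure \<alpha>" by (rule finite_measure_angle_measure[OF \<alpha>'])
  note [measurable] = borel_measurable_translation_integrand_angle[OF \<alpha>' f]
  obtain c where c: "0 \<le> c" "laguerre_norm p \<alpha> {0..} f = ennreal c"
    using fin by (cases "laguerre_norm p \<alpha> {0..} f") auto
  let ?N = "\<lambda>x. \<integral>\<^sup>+\<theta>. ennreal (\<bar>translation_integrand \<alpha> f t x \<theta> * exp (- x / 2)\<bar> powr p) \<partial>angle_measure \<alpha>"
  have "(\<lambda>z. translation_integrand \<alpha> f t (fst z) (snd z)) \<in> borel_measurable (borel \<Otimes>\<^sub>M borel)"
    using measurable_compose[OF _ borel_measurable_translation_integrand[OF \<alpha>' f],
      of "\<lambda>z. ((t, fst z), snd z)" "borel \<Otimes>\<^sub>M borel"] by simp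
  then have "(\<lambda>z. translation_integrand \<alpha> f t (fst z) (snd z)) \<in> borel_measurable (borel \<Otimes>\<^sub>M angle_measure \<alpha>)"
    by (simp cong: measurable_cong_sets sets_pair_measure_cong)
  then have [measurable]: "?N \<in> borel_measurable borel"
    by (intro borel_measurable_nn_integral) (simp add: split_beta')
  have "(\<integral>\<^sup>+x. ?N x * ennreal (x powr \<alpha>) * indicator {0..} x \<partial>lborel) < \<infinity>"
    using nn_integral_translation_integrand_le[OF p \<alpha> t f c(1)] c(2)
    by (auto intro: le_less_trans)
  then have "AE x in lborel. ?N x * ennreal (x powr \<alpha>) * indicator {0..} x \<noteq> \<infinity>"
    by (intro nn_integral_PInf_AE less_imp_neq) measurable
  moreover have "AE x in lborel. x \<noteq> (0::real)" by (rule AE_lborel_singleton)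
  ultimately show ?thesis
  proof eventually_elim
    case (elim x)
    show ?case
    proof
      assume "0 \<le> x"
      then have "?N x < \<infinity>"
        using elim by (auto simp: ennreal_mult_eq_top_iff less_top)
      then have "integrable (angle_measure \<alpha>) (\<lambda>\<theta>. translation_integrand \<alpha> f t x \<theta> * exp (- x / 2))"
        by (intro integrable_of_powr[OF p]) (auto simp: emeasure_angle_measure_UNIV[OF \<alpha>'])
      then show "integrable (angle_measure \<alpha>) (translation_integrand \<alpha> f t x)" by simp
    qed
  qed
qed

text \<open>
  The translation is additive only where both integrands are integrable, which by the previous
  lemma is almost everywhere; this suffices for norms.
\<close>

lemma laguerre_translation_diff_norm_le:
  assumes p: "1 \<le> p" and \<alpha>: "0 \<le> \<alpha>" and t: "0 \<le> t"
    and f: "f \<in> borel_measurable borel" "laguerre_norm p \<alpha> {0..} f < \<infinity>"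
    and g: "g \<in> borel_measurable borel" "laguerre_norm p \<alpha> {0..} g < \<infinity>"
    and c: "0 \<le> c" "laguerre_norm p \<alpha> {0..} (\<lambda>x. f x - g x) \<le> ennreal c"
  shows "laguerre_norm p \<alpha> {0..} (\<lambda>x. laguerre_translation \<alpha> t f x - laguerre_translation \<alpha> t g x)
    \<le> ennreal (exp (t / 2) * c)"
proof -
  have \<alpha>': "- 1 / 2 < \<alpha>" using \<alpha> by simp
  have fg: "(\<lambda>x. f x - g x) \<in> borel_measurable borel" using f(1) g(1) by measurable
  have "AE x in lborel. x \<in> {0..} \<longrightarrow> laguerre_translation \<alpha> t f x - laguerre_translation \<alpha> t g x =
      laguerre_translation \<alpha> t (\<lambda>x. f x - g x) x"
    using AE_integrable_translation_integrand[OF p \<alpha> t f] AE_integrable_translation_integrand[OF p \<alpha> t g]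
  proof eventually_elim
    case (elim x)
    have "translation_integrand \<alpha> (\<lambda>x. f x - g x) t x =
        (\<lambda>\<theta>. translation_integrand \<alpha> f t x \<theta> - translation_integrand \<alpha> g t x \<theta>)"
      by (simp add: translation_integrand_def left_diff_distrib fun_eq_iff)
    then show ?case
      using elim by (simp add: laguerre_translation_eq_integral[OF \<alpha>'] f g fg)
  qed
  then have "laguerre_norm p \<alpha> {0..} (\<lambda>x. laguerre_translation \<alpha> t f x - laguerre_translation \<alpha> t g x) =
      laguerre_norm p \<alpha> {0..} (laguerre_translation \<alpha> t (\<lambda>x. f x - g x))"
    by (rule laguerre_norm_cong_AE)
  also have "\<dots> \<le> ennreal (exp (t / 2) * c)"
    by (rule laguerre_translation_norm_le[OF p \<alpha> t fg c])
  finally show ?thesis .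
qed

section \<open>The translates depend continuously on the translation parameter\<close>

lemma laguerre_norm_add_le':
  assumes "1 \<le> p" "f \<in> borel_measurable borel" "g \<in> borel_measurable borel"
    and "0 \<le> a" "laguerre_norm p \<alpha> {0..} f \<le> ennreal a" "0 \<le> b" "laguerre_norm p \<alpha> {0..} g \<le> ennreal b"
  shows "laguerre_norm p \<alpha> {0..} (\<lambda>x. f x + g x) \<le> ennreal (a + b)"
  using assms by (intro laguerre_norm_add_le set_borel_measurableI) auto

lemma borel_imp_AE_limit_of_continuous:
  fixes f :: "real \<Rightarrow> real"
  assumes "f \<in> borel_measurable borel"
  obtains g where "\<And>k::nat. continuous_on UNIV (g k)" "AE x in lborel. (\<lambda>k. g k x) \<longlonglongrightarrow> f x"
proof -
  have "f \<in> borel_measurable lebesgue" using assms by (intro measurable_completion) simp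
  then have "f measurable_on UNIV" by (rule lebesgue_measurable_imp_measurable_on) simp
  then obtain N g where N: "negligible N" and g: "\<And>k. continuous_on UNIV (g k)"
      "\<And>x. x \<notin> N \<Longrightarrow> (\<lambda>k. g k x) \<longlonglongrightarrow> f x"
    unfolding measurable_on_def by auto
  have "AE x in lebesgue. x \<notin> N" using N by (intro AE_not_in) (simp add: negligible_iff_null_sets)
  then have "AE x in lborel. x \<notin> N" by (simp add: AE_completion_iff)
  then have "AE x in lborel. (\<lambda>k. g k x) \<longlonglongrightarrow> f x" by eventually_elim (rule g(2))
  then show ?thesis using that g(1) by blast
qed

text \<open>
  Cut the support and the values of \<open>f\<close> at a large \<open>n\<close>; then replace \<open>f\<close> under both cuts by
  continuous functions that converge to it almost everywhere. The cuts are continuous and provide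
  the dominating functions of both limits.
\<close>

lemma laguerre_continuous_compact_support_dense:
  assumes p: "1 \<le> p" and \<alpha>: "0 \<le> \<alpha>" and [measurable]: "f \<in> borel_measurable borel"
    and fin: "laguerre_norm p \<alpha> {0..} f < \<infinity>" and e: "0 < e"
  obtains \<phi> R where "continuous_on UNIV \<phi>" "0 \<le> R" "\<And>x. R < x \<Longrightarrow> \<phi> x = 0"
    "laguerre_norm p \<alpha> {0..} (\<lambda>x. f x - \<phi> x) \<le> ennreal e"
proof -
  define cut where "cut n x = max 0 (min 1 (real n + 1 - x))" for n :: nat and x :: real
  define clip where "clip n y = max (- real n) (min (real n) y)" for n :: nat and y :: real
  have [measurable]: "cut n \<in> borel_measurable borel" "clip n \<in> borel_measurable borel" for n
    unfolding cut_def[abs_def] clip_def[abs_def] by measurable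
  have clip: "\<bar>clip n y\<bar> \<le> real n" for n y by (auto simp: clip_def)
  have cut: "0 \<le> cut n x" "cut n x \<le> 1" for n x by (auto simp: cut_def)
  have trunc: "\<bar>y - cut n x * clip n y\<bar> \<le> \<bar>y\<bar>" for n x y
  proof (cases "0 \<le> y")
    case True
    then have "0 \<le> clip n y" "clip n y \<le> y" by (auto simp: clip_def)
    moreover from this have "0 \<le> cut n x * clip n y" "cut n x * clip n y \<le> 1 * clip n y"
      using cut[of n x] mult_right_mono[of "cut n x" 1 "clip n y"] by auto
    ultimately show ?thesis by linarith
  next
    case False
    then have "clip n y \<le> 0" "y \<le> clip n y" by (auto simp: clip_def)
    moreover from this have "cut n x * clip n y \<le> 0" "1 * clip n y \<le> cut n x * clip n y"
      using cut[of n x] mult_right_mono_neg[of "cut n x" 1 "clip n y"] by (auto simp: mult_nonneg_nonpos)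
    ultimately show ?thesis by linarith
  qed
  have "\<exists>n::nat. laguerre_norm p \<alpha> {0..} (\<lambda>x. f x - cut n x * clip n (f x)) \<le> ennreal (e / 2)"
  proof (rule laguerre_norm_dominated_convergence[OF p, where w = f])
    show "AE x in lborel. 0 \<le> x \<longrightarrow> (\<lambda>n. f x - cut n x * clip n (f x)) \<longlonglongrightarrow> 0"
    proof (intro AE_I2 impI)
      fix x :: real
      have "\<forall>\<^sub>F n in sequentially. f x - cut n x * clip n (f x) = 0"
        using eventually_ge_at_top[of "nat \<lceil>\<bar>x\<bar> + \<bar>f x\<bar>\<rceil>"]
      proof eventually_elim
        case (elim n)
        then have "\<bar>x\<bar> + \<bar>f x\<bar> \<le> real n" by linarith
        then have "cut n x = 1" "clip n (f x) = f x" by (auto simp: cut_def clip_def)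
        then show ?case by simp
      qed
      then show "(\<lambda>n. f x - cut n x * clip n (f x)) \<longlonglongrightarrow> 0" by (rule tendsto_eventually)
    qed
  qed (use fin e trunc in auto)
  then obtain n where n: "laguerre_norm p \<alpha> {0..} (\<lambda>x. f x - cut n x * clip n (f x)) \<le> ennreal (e / 2)" ..
  obtain g where g: "\<And>k::nat. continuous_on UNIV (g k)" "AE x in lborel. (\<lambda>k. g k x) \<longlonglongrightarrow> f x"
    by (rule borel_imp_AE_limit_of_continuous[OF assms(3)]) blast
  have [measurable]: "g k \<in> borel_measurable borel" for k
    using g(1) by (rule borel_measurable_continuous_onI)
  define w where "w x = 2 * real n * indicator {..real n + 1} x" for x :: real
  have [measurable]: "w \<in> borel_measurable borel" unfolding w_def[abs_def] by measurable
  have "\<exists>k::nat. laguerre_norm p \<alpha> {0..} (\<lambda>x. cut n x * clip n (f x) - cut n x * clip n (g k x)) \<le> ennreal (e / 2)"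
  proof (rule laguerre_norm_dominated_convergence[OF p, where w = w])
    show "\<bar>cut n x * clip n (f x) - cut n x * clip n (g k x)\<bar> \<le> \<bar>w x\<bar>" for k x
    proof (cases "x \<le> real n + 1")
      case True
      have "\<bar>cut n x * (clip n (f x) - clip n (g k x))\<bar> \<le> 1 * (2 * real n)"
        unfolding abs_mult using cut[of n x] clip[of n "f x"] clip[of n "g k x"] by (intro mult_mono) auto
      then show ?thesis using True by (simp add: w_def right_diff_distrib)
    qed (simp add: cut_def w_def)
    have "laguerre_norm p \<alpha> {0..} w \<le> ennreal (2 * real n * ((real n + 1) powr \<alpha> * (real n + 1)) powr (1 / p))"
      by (rule laguerre_norm_le_of_bounded_support[OF p \<alpha>]) (auto simp: w_def)
    then show "laguerre_norm p \<alpha> {0..} w < \<infinity>" by (rule le_less_trans) simp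
    show "AE x in lborel. 0 \<le> x \<longrightarrow> (\<lambda>k. cut n x * clip n (f x) - cut n x * clip n (g k x)) \<longlonglongrightarrow> 0"
      using g(2)
    proof eventually_elim
      case (elim x)
      then have "(\<lambda>k. cut n x * clip n (f x) - cut n x * clip n (g k x)) \<longlonglongrightarrow> cut n x * clip n (f x) - cut n x * clip n (f x)"
        unfolding clip_def by (intro tendsto_intros)
      then show ?case by simp
    qed
  qed (use e in auto)
  then obtain k where k: "laguerre_norm p \<alpha> {0..} (\<lambda>x. cut n x * clip n (f x) - cut n x * clip n (g k x)) \<le> ennreal (e / 2)" ..
  show ?thesis
  proof (rule that[of "\<lambda>x. cut n x * clip n (g k x)" "real n + 1"])
    show "continuous_on UNIV (\<lambda>x. cut n x * clip n (g k x))"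
      unfolding cut_def clip_def by (intro continuous_intros g)
    have "laguerre_norm p \<alpha> {0..} (\<lambda>x. (f x - cut n x * clip n (f x)) + (cut n x * clip n (f x) - cut n x * clip n (g k x)))
        \<le> ennreal (e / 2 + e / 2)"
      using n k e by (intro laguerre_norm_add_le'[OF p]) auto
    then show "laguerre_norm p \<alpha> {0..} (\<lambda>x. f x - cut n x * clip n (g k x)) \<le> ennreal e" by simp
  qed (auto simp: cut_def)
qed

lemma AE_angle_measure: "AE \<theta> in angle_measure \<alpha>. \<theta> \<in> {0..pi}"
  unfolding angle_measure_def by (subst AE_density) (auto simp: angle_density_def indicator_def)

text \<open>
  For such \<open>\<phi>\<close> the integrand is uniformly continuous in \<open>(x, t, \<theta>)\<close> on compact sets, and
  the translates by bounded \<open>t\<close> vanish outside a common bounded interval, because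
  \<open>x + t + 2 \<surd>(x t) cos \<theta> \<ge> x / 2 - t\<close>. So they depend on \<open>t\<close> uniformly continuously in
  the supremum norm, which there dominates the weighted norm.
\<close>

lemma laguerre_translation_continuous_compact_support:
  assumes p: "1 \<le> p" and \<alpha>: "0 \<le> \<alpha>" and cont: "continuous_on UNIV \<phi>" and R: "0 \<le> R"
    and supp: "\<And>x. R < x \<Longrightarrow> \<phi> x = 0" and M: "0 \<le> M" and e: "0 < e"
  obtains \<delta> where "0 < \<delta>" "\<delta> \<le> 1" "\<And>t h. \<lbrakk>0 \<le> t; t \<le> M; 0 \<le> h; h \<le> \<delta>\<rbrakk> \<Longrightarrow>
    laguerre_norm p \<alpha> {0..} (\<lambda>x. laguerre_translation \<alpha> (t + h) \<phi> x - laguerre_translation \<alpha> t \<phi> x) \<le> ennreal e"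
proof -
  have \<alpha>': "- 1 / 2 < \<alpha>" using \<alpha> by simp
  interpret finite_measure "angle_measure \<alpha>" by (rule finite_measure_angle_measure[OF \<alpha>'])
  have [measurable]: "\<phi> \<in> borel_measurable borel" using cont by (rule borel_measurable_continuous_onI)
  note [measurable] = borel_measurable_translation_integrand_angle[OF \<alpha>' this]
  define R' where "R' = 2 * (R + M + 1)"
  define D where "D = (R' powr \<alpha> * R') powr (1 / p)"
  define \<Psi> where "\<Psi> z = translation_integrand \<alpha> \<phi> (fst (snd z)) (fst z) (snd (snd z))" for z
  define Z where "Z = {0..R'} \<times> {0..M + 1} \<times> {0..pi}"
  have Z: "compact Z" unfolding Z_def by (intro compact_Times compact_Icc)
  have \<Psi>: "continuous_on Z \<Psi>"
    unfolding \<Psi>_def translation_integrand_def using \<alpha>'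
    by (intro continuous_intros continuous_on_bessel_j continuous_on_compose2[OF cont]) auto
  have R': "0 \<le> R'" using R M by (simp add: R'_def)
  have vanish: "translation_integrand \<alpha> \<phi> t x \<theta> = 0" if "0 \<le> t" "t \<le> M + 1" "R' < x" for t x \<theta>
  proof -
    have x: "0 \<le> x" using that R' by simp
    have "- sqrt (x * t) \<le> sqrt (x * t) * cos \<theta>"
      using x that mult_left_mono[of "- 1" "cos \<theta>" "sqrt (x * t)"] by simp
    moreover have "0 \<le> x / 2 + 2 * t - 2 * sqrt (x * t)"
    proof -
      have "0 \<le> (sqrt (x / 2) - sqrt (2 * t))\<^sup>2" by simp
      also have "\<dots> = x / 2 + 2 * t - 2 * (sqrt (x / 2) * sqrt (2 * t))"
        using x that by (simp add: power2_diff)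
      also have "sqrt (x / 2) * sqrt (2 * t) = sqrt (x * t)"
        by (simp add: real_sqrt_mult[symmetric])
      finally show ?thesis .
    qed
    moreover have "R < x + t + 2 * q" if "- s \<le> q" "0 \<le> x / 2 + 2 * t - 2 * s" for q s
      using that \<open>t \<le> M + 1\<close> \<open>R' < x\<close> unfolding R'_def by argo
    ultimately have "R < x + t + 2 * (sqrt (x * t) * cos \<theta>)" by blast
    then show ?thesis using supp by (simp add: translation_integrand_def mult.assoc)
  qed
  have int: "integrable (angle_measure \<alpha>) (translation_integrand \<alpha> \<phi> t x)"
    if "0 \<le> t" "t \<le> M + 1" "0 \<le> x" "x \<le> R'" for t x
  proof -
    obtain B where B: "\<And>z. z \<in> Z \<Longrightarrow> norm (\<Psi> z) \<le> B"
      using compact_imp_bounded[OF compact_continuous_image[OF \<Psi> Z]] by (auto simp: bounded_iff)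
    have "AE \<theta> in angle_measure \<alpha>. norm (translation_integrand \<alpha> \<phi> t x \<theta>) \<le> B"
      using AE_angle_measure
      by eventually_elim (use that B[of "(x, t, _)"] in \<open>auto simp: Z_def \<Psi>_def\<close>)
    then show ?thesis by (rule integrable_const_bound) measurable
  qed
  \<comment> \<open>adding one keeps the divisor positive; here \<open>D\<close> is the weight of the common interval\<close>
  define e' where "e' = e / (D + 1)"
  have D: "0 \<le> D" by (simp add: D_def)
  have e': "0 < e'" "e' * D \<le> e" using e D by (auto simp: e'_def field_simps)
  obtain d where d: "0 < d" "\<And>z z'. z \<in> Z \<Longrightarrow> z' \<in> Z \<Longrightarrow> dist z' z < d \<Longrightarrow> dist (\<Psi> z') (\<Psi> z) < e'"
    using compact_uniformly_continuous[OF \<Psi> Z] e'(1) unfolding uniformly_continuous_on_def by metis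
  show ?thesis
  proof (rule that[of "min 1 (d / 2)"])
    fix t h assume t: "0 \<le> t" "t \<le> M" and h: "0 \<le> h" "h \<le> min 1 (d / 2)"
    have "laguerre_norm p \<alpha> {0..} (\<lambda>x. laguerre_translation \<alpha> (t + h) \<phi> x - laguerre_translation \<alpha> t \<phi> x)
        \<le> ennreal (e' * (R' powr \<alpha> * R') powr (1 / p))"
    proof (rule laguerre_norm_le_of_bounded_support[OF p \<alpha> less_imp_le[OF e'(1)] R'])
      fix x assume "R' < x"
      then have "translation_integrand \<alpha> \<phi> (t + h) x \<theta> = 0" "translation_integrand \<alpha> \<phi> t x \<theta> = 0" for \<theta>
        using t h by (auto intro!: vanish)
      then show "laguerre_translation \<alpha> (t + h) \<phi> x - laguerre_translation \<alpha> t \<phi> x = 0"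
        by (simp add: laguerre_translation_eq_integral[OF \<alpha>'])
    next
      fix x assume x: "0 \<le> x" "x \<le> R'"
      have i: "integrable (angle_measure \<alpha>) (translation_integrand \<alpha> \<phi> (t + h) x)"
        "integrable (angle_measure \<alpha>) (translation_integrand \<alpha> \<phi> t x)"
        using t h x by (auto intro!: int)
      have "AE \<theta> in angle_measure \<alpha>. norm (translation_integrand \<alpha> \<phi> (t + h) x \<theta> - translation_integrand \<alpha> \<phi> t x \<theta>) \<le> e'"
        using AE_angle_measure
      proof eventually_elim
        case (elim \<theta>)
        have "dist (x, t + h, \<theta>) (x, t, \<theta>) < d"
          using h d(1) by (simp add: dist_Pair_Pair dist_real_def)
        then have "dist (\<Psi> (x, t + h, \<theta>)) (\<Psi> (x, t, \<theta>)) < e'"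
          using elim t h x by (intro d(2)) (auto simp: Z_def)
        then show ?case by (simp add: \<Psi>_def dist_norm)
      qed
      then have "(\<integral>\<theta>. norm (translation_integrand \<alpha> \<phi> (t + h) x \<theta> - translation_integrand \<alpha> \<phi> t x \<theta>) \<partial>angle_measure \<alpha>)
          \<le> (\<integral>\<theta>. e' \<partial>angle_measure \<alpha>)"
        using i by (intro integral_mono_AE) auto
      also have "\<dots> = e'" by (simp add: measure_def emeasure_angle_measure_UNIV[OF \<alpha>'])
      finally have "norm (\<integral>\<theta>. translation_integrand \<alpha> \<phi> (t + h) x \<theta> - translation_integrand \<alpha> \<phi> t x \<theta> \<partial>angle_measure \<alpha>) \<le> e'"
        by (rule order_trans[OF integral_norm_bound])
      then show "\<bar>laguerre_translation \<alpha> (t + h) \<phi> x - laguerre_translation \<alpha> t \<phi> x\<bar> \<le> e'"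
        using i by (simp add: laguerre_translation_eq_integral[OF \<alpha>'])
    qed
    also have "\<dots> \<le> ennreal e" using e'(2) by (intro ennreal_leI) (simp add: D_def)
    finally show "laguerre_norm p \<alpha> {0..} (\<lambda>x. laguerre_translation \<alpha> (t + h) \<phi> x - laguerre_translation \<alpha> t \<phi> x) \<le> ennreal e" .
  qed (use d(1) in auto)
qed

lemma laguerre_functions_borelI:
  "f \<in> borel_measurable borel \<Longrightarrow> laguerre_norm p \<alpha> {0..} f < \<infinity> \<Longrightarrow> f \<in> laguerre_functions p \<alpha>"
  by (simp add: laguerre_functions_def set_borel_measurableI)

text \<open>
  The translations by \<open>t \<le> M + 1\<close> are bounded by \<open>exp ((M + 1) / 2)\<close> uniformly, so the
  continuity passes from a dense set to all functions.
\<close>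

lemma laguerre_translation_uniformly_continuous:
  assumes p: "1 \<le> p" and \<alpha>: "0 \<le> \<alpha>" and f: "f \<in> borel_measurable borel" "laguerre_norm p \<alpha> {0..} f < \<infinity>"
    and M: "0 \<le> M" and e: "0 < e"
  obtains \<delta> where "0 < \<delta>" "\<delta> \<le> 1" "\<And>t h. \<lbrakk>0 \<le> t; t \<le> M; 0 \<le> h; h \<le> \<delta>\<rbrakk> \<Longrightarrow>
    laguerre_norm p \<alpha> {0..} (\<lambda>x. laguerre_translation \<alpha> (t + h) f x - laguerre_translation \<alpha> t f x) \<le> ennreal e"
proof -
  have \<alpha>': "- 1 / 2 < \<alpha>" using \<alpha> by simp
  define E where "E = exp ((M + 1) / 2)"
  have E: "0 < E" by (simp add: E_def)
  define e' where "e' = e / (3 * E)"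
  have e': "0 < e'" "E * e' = e / 3" using e E by (auto simp: e'_def)
  obtain \<phi> R where \<phi>: "continuous_on UNIV \<phi>" "0 \<le> R" "\<And>x. R < x \<Longrightarrow> \<phi> x = 0"
      and close: "laguerre_norm p \<alpha> {0..} (\<lambda>x. f x - \<phi> x) \<le> ennreal e'"
    by (rule laguerre_continuous_compact_support_dense[OF p \<alpha> f e'(1)]) blast
  have \<phi>b: "\<phi> \<in> borel_measurable borel" using \<phi>(1) by (rule borel_measurable_continuous_onI)
  have "(\<lambda>x. f x - \<phi> x) \<in> laguerre_functions p \<alpha>"
    using f(1) \<phi>b close by (intro laguerre_functions_borelI) (auto intro: le_less_trans)
  from laguerre_functions_diff[OF p laguerre_functions_borelI[OF f] this]
  have \<phi>n: "laguerre_norm p \<alpha> {0..} \<phi> < \<infinity>" by (simp add: laguerre_functions_def)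
  obtain \<delta> where \<delta>: "0 < \<delta>" "\<delta> \<le> 1" "\<And>t h. \<lbrakk>0 \<le> t; t \<le> M; 0 \<le> h; h \<le> \<delta>\<rbrakk> \<Longrightarrow>
      laguerre_norm p \<alpha> {0..} (\<lambda>x. laguerre_translation \<alpha> (t + h) \<phi> x - laguerre_translation \<alpha> t \<phi> x) \<le> ennreal (e / 3)"
    by (rule laguerre_translation_continuous_compact_support[OF p \<alpha> \<phi> M, of "e / 3"]) (use e in auto)
  have approx: "laguerre_norm p \<alpha> {0..} (\<lambda>x. laguerre_translation \<alpha> t f x - laguerre_translation \<alpha> t \<phi> x) \<le> ennreal (e / 3)"
    if "0 \<le> t" "t \<le> M + 1" for t
  proof -
    have "laguerre_norm p \<alpha> {0..} (\<lambda>x. laguerre_translation \<alpha> t f x - laguerre_translation \<alpha> t \<phi> x) \<le> ennreal (exp (t / 2) * e')"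
      using e' by (intro laguerre_translation_diff_norm_le[OF p \<alpha> that(1) f \<phi>b \<phi>n] close) auto
    also have "\<dots> \<le> ennreal (E * e')"
      using that e' by (intro ennreal_leI mult_right_mono) (auto simp: E_def)
    finally show ?thesis by (simp add: e')
  qed
  show ?thesis
  proof (rule that[OF \<delta>(1,2)])
    fix t h assume th: "0 \<le> t" "t \<le> M" "0 \<le> h" "h \<le> \<delta>"
    note [measurable] = borel_measurable_laguerre_translation_right[OF \<alpha>' f(1)]
      borel_measurable_laguerre_translation_right[OF \<alpha>' \<phi>b]
    have 3: "laguerre_norm p \<alpha> {0..} (\<lambda>x. laguerre_translation \<alpha> t \<phi> x - laguerre_translation \<alpha> t f x) \<le> ennreal (e / 3)"
      using approx[of t] th by (subst laguerre_norm_minus_commute) auto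
    have "laguerre_norm p \<alpha> {0..} (\<lambda>x. (laguerre_translation \<alpha> (t + h) f x - laguerre_translation \<alpha> (t + h) \<phi> x) +
        ((laguerre_translation \<alpha> (t + h) \<phi> x - laguerre_translation \<alpha> t \<phi> x) +
         (laguerre_translation \<alpha> t \<phi> x - laguerre_translation \<alpha> t f x))) \<le> ennreal (e / 3 + (e / 3 + e / 3))"
      using th \<delta> e by (intro laguerre_norm_add_le'[OF p] approx 3) auto
    then show "laguerre_norm p \<alpha> {0..} (\<lambda>x. laguerre_translation \<alpha> (t + h) f x - laguerre_translation \<alpha> t f x) \<le> ennreal e"
      by simp
  qed
qed

section \<open>Means of translates\<close>

definition mean_density :: "real \<Rightarrow> real \<Rightarrow> real \<Rightarrow> real" where
  "mean_density \<alpha> \<delta> h = indicator {0..\<delta>} h * ((\<alpha> + 1) / \<delta> powr (\<alpha> + 1) * h powr \<alpha>)"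

definition mean_measure :: "real \<Rightarrow> real \<Rightarrow> real measure" where
  "mean_measure \<alpha> \<delta> = density lborel (\<lambda>h. ennreal (mean_density \<alpha> \<delta> h))"

text \<open>
  The average of the translates by \<open>h \<in> [0, \<delta>]\<close>, a mollification of \<open>f\<close>. The weight
  \<open>h\<^sup>\<alpha>\<close> matches the norm, so that the mean is controlled by the norm of a translate.
\<close>

definition laguerre_mean :: "real \<Rightarrow> real \<Rightarrow> (real \<Rightarrow> real) \<Rightarrow> real \<Rightarrow> real" where
  "laguerre_mean \<alpha> \<delta> f x = (\<integral>h. laguerre_translation \<alpha> h f x \<partial>mean_measure \<alpha> \<delta>)"

lemma sets_mean_measure [measurable_cong, simp]: "sets (mean_measure \<alpha> \<delta>) = sets borel"
  by (simp add: mean_measure_def)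

lemma space_mean_measure [simp]: "space (mean_measure \<alpha> \<delta>) = UNIV"
  by (simp add: mean_measure_def)

lemma mean_density_measurable [measurable]: "mean_density \<alpha> \<delta> \<in> borel_measurable borel"
  unfolding mean_density_def[abs_def] by measurable

lemma AE_mean_measure: "AE h in mean_measure \<alpha> \<delta>. h \<in> {0..\<delta>}"
  unfolding mean_measure_def by (subst AE_density) (auto simp: mean_density_def indicator_def)

lemma emeasure_mean_measure_UNIV:
  assumes \<alpha>: "0 \<le> \<alpha>" and \<delta>: "0 < \<delta>"
  shows "emeasure (mean_measure \<alpha> \<delta>) UNIV = 1"
proof -
  define C where "C = (\<alpha> + 1) / \<delta> powr (\<alpha> + 1)"
  have "0 \<le> C" using \<alpha> by (simp add: C_def)
  have "((\<lambda>h. C * h powr \<alpha>) has_integral C * (\<delta> powr (\<alpha> + 1) / (\<alpha> + 1))) {0..\<delta>}"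
    using has_integral_powr_from_0[of \<alpha> \<delta>] \<alpha> \<delta> by (intro has_integral_mult_right) simp
  then have "(\<integral>\<^sup>+h. ennreal (indicator {0..\<delta>} h * (C * h powr \<alpha>)) \<partial>lborel) = ennreal (C * (\<delta> powr (\<alpha> + 1) / (\<alpha> + 1)))"
    using \<open>0 \<le> C\<close> by (intro nn_integral_has_integral_lebesgue) auto
  also have "C * (\<delta> powr (\<alpha> + 1) / (\<alpha> + 1)) = 1"
    using \<alpha> \<delta> by (simp add: C_def)
  finally show ?thesis
    by (simp add: mean_measure_def emeasure_density mean_density_def C_def)
qed

lemma finite_measure_mean_measure: "0 \<le> \<alpha> \<Longrightarrow> 0 < \<delta> \<Longrightarrow> finite_measure (mean_measure \<alpha> \<delta>)"
  by (rule finite_measureI) (simp add: emeasure_mean_measure_UNIV)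

text \<open>
  A bound for the norm of the functional that integrates against the mean measure; the exponential pays for the factor \<open>exp (- h / 2)\<close> of
  the Laguerre norm on \<open>[0, \<delta>]\<close>.
\<close>

definition mean_const :: "real \<Rightarrow> real \<Rightarrow> real \<Rightarrow> real" where
  "mean_const p \<alpha> \<delta> = ((\<alpha> + 1) / \<delta> powr (\<alpha> + 1)) powr (1 / p) * exp (\<delta> / 2)"

lemma mean_const_pos: "0 \<le> \<alpha> \<Longrightarrow> 0 < \<delta> \<Longrightarrow> 0 < mean_const p \<alpha> \<delta>"
  by (simp add: mean_const_def)

lemma nn_integral_mean_measure_powr_le:
  assumes p: "1 \<le> p" and \<alpha>: "0 \<le> \<alpha>" and \<delta>: "0 < \<delta>" and [measurable]: "g \<in> borel_measurable borel"
    and a: "0 \<le> a" "laguerre_norm p \<alpha> {0..} g \<le> ennreal a"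
  shows "(\<integral>\<^sup>+h. ennreal (\<bar>g h\<bar> powr p) \<partial>mean_measure \<alpha> \<delta>) \<le> ennreal ((mean_const p \<alpha> \<delta> * a) powr p)"
proof -
  define k where "k = (\<alpha> + 1) / \<delta> powr (\<alpha> + 1)"
  have k: "0 \<le> k" using \<alpha> by (simp add: k_def)
  define e where "e = exp (\<delta> / 2) powr p"
  have e: "0 \<le> e" by (simp add: e_def)
  have "(\<integral>\<^sup>+h. ennreal (\<bar>g h\<bar> powr p) \<partial>mean_measure \<alpha> \<delta>) =
      (\<integral>\<^sup>+h. ennreal (mean_density \<alpha> \<delta> h) * ennreal (\<bar>g h\<bar> powr p) \<partial>lborel)"
    unfolding mean_measure_def by (subst nn_integral_density) auto
  also have "\<dots> \<le> (\<integral>\<^sup>+h. ennreal (k * e) * (ennreal (\<bar>g h * exp (- h / 2)\<bar> powr p * h powr \<alpha>) * indicator {0..} h) \<partial>lborel)"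
  proof (rule nn_integral_mono)
    fix h :: real
    show "ennreal (mean_density \<alpha> \<delta> h) * ennreal (\<bar>g h\<bar> powr p) \<le>
        ennreal (k * e) * (ennreal (\<bar>g h * exp (- h / 2)\<bar> powr p * h powr \<alpha>) * indicator {0..} h)"
    proof (cases "h \<in> {0..\<delta>}")
      case True
      have "1 \<le> exp (\<delta> / 2) * exp (- h / 2)"
        using True by (simp add: exp_add[symmetric])
      then have "\<bar>g h\<bar> * 1 \<le> \<bar>g h\<bar> * (exp (\<delta> / 2) * exp (- h / 2))"
        by (rule mult_left_mono) simp
      then have "\<bar>g h\<bar> \<le> exp (\<delta> / 2) * \<bar>g h * exp (- h / 2)\<bar>"
        by (simp add: abs_mult mult_ac)
      then have "\<bar>g h\<bar> powr p \<le> (exp (\<delta> / 2) * \<bar>g h * exp (- h / 2)\<bar>) powr p"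
        using p by (intro powr_mono2) auto
      also have "\<dots> = e * \<bar>g h * exp (- h / 2)\<bar> powr p"
        unfolding e_def by (rule powr_mult)
      finally have "k * h powr \<alpha> * \<bar>g h\<bar> powr p \<le> k * h powr \<alpha> * (e * \<bar>g h * exp (- h / 2)\<bar> powr p)"
        using k by (intro mult_left_mono) auto
      also have "\<dots> = k * e * (\<bar>g h * exp (- h / 2)\<bar> powr p * h powr \<alpha>)" by (simp only: mult_ac)
      finally have "ennreal (k * h powr \<alpha> * \<bar>g h\<bar> powr p) \<le> ennreal (k * e * (\<bar>g h * exp (- h / 2)\<bar> powr p * h powr \<alpha>))"
        by (rule ennreal_leI)
      then show ?thesis
        using True k e by (simp add: mean_density_def k_def[symmetric] ennreal_mult)
    qed (simp add: mean_density_def)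
  qed
  also have "\<dots> = ennreal (k * e) * (\<integral>\<^sup>+h\<in>{0..}. ennreal (\<bar>g h * exp (- h / 2)\<bar> powr p * h powr \<alpha>) \<partial>lborel)"
    by (rule nn_integral_cmult) measurable
  also have "\<dots> \<le> ennreal (k * e) * ennreal (a powr p)"
    using a laguerre_norm_le_iff[OF p a(1)] by (intro mult_left_mono) auto
  also have "\<dots> = ennreal (k * e * a powr p)" using k e by (simp add: ennreal_mult)
  also have "k * e * a powr p = (mean_const p \<alpha> \<delta> * a) powr p"
    using p k by (simp add: mean_const_def k_def[symmetric] e_def powr_mult powr_powr)
  finally show ?thesis .
qed

text \<open>
  The form in which Hoelder's inequality is used: a pointwise bound by a norm. It turns
  continuity of translates in norm into continuity of the mean in \<open>x\<close>.
\<close>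

lemma mean_measure_integral_le:
  assumes p: "1 \<le> p" and \<alpha>: "0 \<le> \<alpha>" and \<delta>: "0 < \<delta>" and [measurable]: "g \<in> borel_measurable borel"
    and a: "0 \<le> a" "laguerre_norm p \<alpha> {0..} g \<le> ennreal a"
  shows "integrable (mean_measure \<alpha> \<delta>) g" and "\<bar>integral\<^sup>L (mean_measure \<alpha> \<delta>) g\<bar> \<le> mean_const p \<alpha> \<delta> * a"
proof -
  have M: "emeasure (mean_measure \<alpha> \<delta>) (space (mean_measure \<alpha> \<delta>)) \<le> 1"
    by (simp add: emeasure_mean_measure_UNIV[OF \<alpha> \<delta>])
  note le = nn_integral_mean_measure_powr_le[OF assms]
  have "(\<integral>\<^sup>+h. ennreal (\<bar>g h\<bar> powr p) \<partial>mean_measure \<alpha> \<delta>) < \<infinity>" using le by (rule le_less_trans) simp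
  then show int: "integrable (mean_measure \<alpha> \<delta>) g" by (intro integrable_of_powr[OF p M]) auto
  have c: "0 \<le> mean_const p \<alpha> \<delta> * a" using a mean_const_pos[OF \<alpha> \<delta>, of p] by simp
  have "(\<integral>\<^sup>+h. ennreal \<bar>g h\<bar> \<partial>mean_measure \<alpha> \<delta>) \<le> ennreal (mean_const p \<alpha> \<delta> * a)"
    by (rule nn_integral_le_of_powr[OF p M _ _ c le]) auto
  with integral_norm_bound_ennreal[OF int]
  have "ennreal \<bar>integral\<^sup>L (mean_measure \<alpha> \<delta>) g\<bar> \<le> ennreal (mean_const p \<alpha> \<delta> * a)"
    by (auto intro: order_trans)
  then show "\<bar>integral\<^sup>L (mean_measure \<alpha> \<delta>) g\<bar> \<le> mean_const p \<alpha> \<delta> * a"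
    using c by (subst (asm) ennreal_le_iff) auto
qed

text \<open>
  The translation is symmetric in \<open>x\<close> and \<open>t\<close>, so the mean at \<open>x\<close> is an integral of the
  translate by \<open>x\<close>. This is why a modulus of continuity of \<open>x \<mapsto> T\<^sub>x f\<close> is one of the mean.
\<close>

lemma laguerre_mean_eq: "laguerre_mean \<alpha> \<delta> f x = (\<integral>h. laguerre_translation \<alpha> x f h \<partial>mean_measure \<alpha> \<delta>)"
  unfolding laguerre_mean_def by (subst laguerre_translation_commute) (rule refl)

lemma laguerre_mean_abs_le:
  assumes p: "1 \<le> p" and \<alpha>: "0 \<le> \<alpha>" and \<delta>: "0 < \<delta>" and f: "f \<in> borel_measurable borel"
    and b: "0 \<le> b" "laguerre_norm p \<alpha> {0..} f \<le> ennreal b" and x: "0 \<le> x"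
  shows "integrable (mean_measure \<alpha> \<delta>) (laguerre_translation \<alpha> x f)"
    and "\<bar>laguerre_mean \<alpha> \<delta> f x\<bar> \<le> mean_const p \<alpha> \<delta> * (exp (x / 2) * b)"
proof -
  have \<alpha>': "- 1 / 2 < \<alpha>" using \<alpha> by simp
  have c: "0 \<le> exp (x / 2) * b" using b by simp
  note mean_measure_integral_le[OF p \<alpha> \<delta> borel_measurable_laguerre_translation_right[OF \<alpha>' f] c
      laguerre_translation_norm_le[OF p \<alpha> x f b]]
  then show "integrable (mean_measure \<alpha> \<delta>) (laguerre_translation \<alpha> x f)"
    and "\<bar>laguerre_mean \<alpha> \<delta> f x\<bar> \<le> mean_const p \<alpha> \<delta> * (exp (x / 2) * b)"
    unfolding laguerre_mean_eq by blast+
qed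

lemma laguerre_mean_diff_le:
  assumes p: "1 \<le> p" and \<alpha>: "0 \<le> \<alpha>" and \<delta>: "0 < \<delta>"
    and f: "f \<in> borel_measurable borel" "laguerre_norm p \<alpha> {0..} f < \<infinity>"
    and xy: "0 \<le> x" "0 \<le> y" and a: "0 \<le> a"
      "laguerre_norm p \<alpha> {0..} (\<lambda>h. laguerre_translation \<alpha> x f h - laguerre_translation \<alpha> y f h) \<le> ennreal a"
  shows "\<bar>laguerre_mean \<alpha> \<delta> f x - laguerre_mean \<alpha> \<delta> f y\<bar> \<le> mean_const p \<alpha> \<delta> * a"
proof -
  have \<alpha>': "- 1 / 2 < \<alpha>" using \<alpha> by simp
  note [measurable] = borel_measurable_laguerre_translation_right[OF \<alpha>' f(1)]
  obtain b where b: "0 \<le> b" "laguerre_norm p \<alpha> {0..} f \<le> ennreal b"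
    using f(2) by (cases "laguerre_norm p \<alpha> {0..} f") auto
  have "laguerre_mean \<alpha> \<delta> f x - laguerre_mean \<alpha> \<delta> f y =
      (\<integral>h. laguerre_translation \<alpha> x f h - laguerre_translation \<alpha> y f h \<partial>mean_measure \<alpha> \<delta>)"
    unfolding laguerre_mean_eq
    by (intro Bochner_Integration.integral_diff[symmetric] laguerre_mean_abs_le[OF p \<alpha> \<delta> f(1) b] xy)
  also have "\<bar>\<dots>\<bar> \<le> mean_const p \<alpha> \<delta> * a"
    by (rule mean_measure_integral_le[OF p \<alpha> \<delta> _ a]) measurable
  finally show ?thesis .
qed

lemma borel_measurable_laguerre_mean:
  assumes \<alpha>: "0 \<le> \<alpha>" and \<delta>: "0 < \<delta>" and f: "f \<in> borel_measurable borel"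
  shows "laguerre_mean \<alpha> \<delta> f \<in> borel_measurable borel"
proof -
  have \<alpha>': "- 1 / 2 < \<alpha>" using \<alpha> by simp
  interpret finite_measure "mean_measure \<alpha> \<delta>" by (rule finite_measure_mean_measure[OF \<alpha> \<delta>])
  show ?thesis unfolding laguerre_mean_eq[abs_def]
    using borel_measurable_laguerre_translation[OF \<alpha>' f]
    by (intro borel_measurable_lebesgue_integral) (simp cong: measurable_cong_sets sets_pair_measure_cong)
qed

text \<open>
  Jensen's inequality at each \<open>x\<close> and Tonelli's theorem: the error of an average is at most the
  largest of the averaged errors.
\<close>

lemma laguerre_mean_approximates:
  assumes p: "1 \<le> p" and \<alpha>: "0 \<le> \<alpha>" and \<delta>: "0 < \<delta>"
    and f: "f \<in> borel_measurable borel" "laguerre_norm p \<alpha> {0..} f < \<infinity>" and e: "0 \<le> e"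
    and close: "\<And>h. 0 \<le> h \<Longrightarrow> h \<le> \<delta> \<Longrightarrow>
      laguerre_norm p \<alpha> {0..} (\<lambda>x. laguerre_translation \<alpha> h f x - f x) \<le> ennreal e"
  shows "laguerre_norm p \<alpha> {0..} (\<lambda>x. laguerre_mean \<alpha> \<delta> f x - f x) \<le> ennreal e"
proof -
  have \<alpha>': "- 1 / 2 < \<alpha>" using \<alpha> by simp
  interpret \<nu>: finite_measure "mean_measure \<alpha> \<delta>" by (rule finite_measure_mean_measure[OF \<alpha> \<delta>])
  interpret pair: pair_sigma_finite "mean_measure \<alpha> \<delta>" "lborel :: real measure" ..
  have M: "emeasure (mean_measure \<alpha> \<delta>) (space (mean_measure \<alpha> \<delta>)) \<le> 1"
    by (simp add: emeasure_mean_measure_UNIV[OF \<alpha> \<delta>])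
  note [measurable] = f(1) borel_measurable_laguerre_translation[OF \<alpha>' f(1)]
  have [measurable]: "(\<lambda>h. laguerre_translation \<alpha> h f x) \<in> borel_measurable borel" for x
    unfolding laguerre_translation_commute[of \<alpha> _ f x]
    by (rule borel_measurable_laguerre_translation_right[OF \<alpha>' f(1)])
  obtain b where b: "0 \<le> b" "laguerre_norm p \<alpha> {0..} f \<le> ennreal b"
    using f(2) by (cases "laguerre_norm p \<alpha> {0..} f") auto
  let ?v = "\<lambda>x h. (laguerre_translation \<alpha> h f x - f x) * exp (- x / 2)"
  have pointwise: "ennreal (\<bar>(laguerre_mean \<alpha> \<delta> f x - f x) * exp (- x / 2)\<bar> powr p) \<le>
      (\<integral>\<^sup>+h. ennreal (\<bar>?v x h\<bar> powr p) \<partial>mean_measure \<alpha> \<delta>)" if x: "0 \<le> x" for x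
  proof -
    have "integrable (mean_measure \<alpha> \<delta>) (\<lambda>h. laguerre_translation \<alpha> h f x)"
      unfolding laguerre_translation_commute[of \<alpha> _ f x]
      by (rule laguerre_mean_abs_le[OF p \<alpha> \<delta> f(1) b x])
    then have "(\<integral>h. ?v x h \<partial>mean_measure \<alpha> \<delta>) = (laguerre_mean \<alpha> \<delta> f x - f x) * exp (- x / 2)"
      by (simp add: laguerre_mean_def measure_def emeasure_mean_measure_UNIV[OF \<alpha> \<delta>])
    moreover have "ennreal (\<bar>\<integral>h. ?v x h \<partial>mean_measure \<alpha> \<delta>\<bar> powr p) \<le>
        (\<integral>\<^sup>+h. ennreal (\<bar>?v x h\<bar> powr p) \<partial>mean_measure \<alpha> \<delta>)"
      by (rule integral_powr_le[OF p M]) measurable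
    ultimately show ?thesis by simp
  qed
  have "(\<integral>\<^sup>+x\<in>{0..}. ennreal (\<bar>(laguerre_mean \<alpha> \<delta> f x - f x) * exp (- x / 2)\<bar> powr p * x powr \<alpha>) \<partial>lborel) \<le>
      (\<integral>\<^sup>+x. \<integral>\<^sup>+h. ennreal (\<bar>?v x h\<bar> powr p * x powr \<alpha>) * indicator {0..} x \<partial>mean_measure \<alpha> \<delta> \<partial>lborel)"
  proof (rule nn_integral_mono)
    fix x :: real
    show "ennreal (\<bar>(laguerre_mean \<alpha> \<delta> f x - f x) * exp (- x / 2)\<bar> powr p * x powr \<alpha>) * indicator {0..} x \<le>
        (\<integral>\<^sup>+h. ennreal (\<bar>?v x h\<bar> powr p * x powr \<alpha>) * indicator {0..} x \<partial>mean_measure \<alpha> \<delta>)"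
    proof (cases "0 \<le> x")
      case True
      have "ennreal (\<bar>(laguerre_mean \<alpha> \<delta> f x - f x) * exp (- x / 2)\<bar> powr p) * ennreal (x powr \<alpha>) \<le>
          (\<integral>\<^sup>+h. ennreal (\<bar>?v x h\<bar> powr p) \<partial>mean_measure \<alpha> \<delta>) * ennreal (x powr \<alpha>)"
        using pointwise[OF True] by (rule mult_right_mono) simp
      also have "\<dots> = (\<integral>\<^sup>+h. ennreal (\<bar>?v x h\<bar> powr p) * ennreal (x powr \<alpha>) \<partial>mean_measure \<alpha> \<delta>)"
        by (rule nn_integral_multc[symmetric]) measurable
      finally show ?thesis using True by (simp add: ennreal_mult)
    qed simp
  qed
  also have "\<dots> = (\<integral>\<^sup>+h. \<integral>\<^sup>+x. ennreal (\<bar>?v x h\<bar> powr p * x powr \<alpha>) * indicator {0..} x \<partial>lborel \<partial>mean_measure \<alpha> \<delta>)"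
  proof (rule pair.Fubini')
    show "(\<lambda>(h, x). ennreal (\<bar>?v x h\<bar> powr p * x powr \<alpha>) * indicator {0..} x)
        \<in> borel_measurable (mean_measure \<alpha> \<delta> \<Otimes>\<^sub>M lborel)"
    proof -
      have [measurable]: "(\<lambda>z. laguerre_translation \<alpha> (fst z) f (snd z)) \<in> borel_measurable (borel \<Otimes>\<^sub>M borel)"
        using borel_measurable_laguerre_translation[OF \<alpha>' f(1)] by (simp add: split_beta')
      have "(\<lambda>z. ennreal (\<bar>?v (snd z) (fst z)\<bar> powr p * snd z powr \<alpha>) * indicator {0..} (snd z))
          \<in> borel_measurable (borel \<Otimes>\<^sub>M borel)" by measurable
      then show ?thesis by (simp add: split_beta' cong: measurable_cong_sets sets_pair_measure_cong)
    qed
  qed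
  also have "\<dots> \<le> (\<integral>\<^sup>+h. ennreal (e powr p) \<partial>mean_measure \<alpha> \<delta>)"
  proof (rule nn_integral_mono_AE)
    show "AE h in mean_measure \<alpha> \<delta>.
        (\<integral>\<^sup>+x. ennreal (\<bar>?v x h\<bar> powr p * x powr \<alpha>) * indicator {0..} x \<partial>lborel) \<le> ennreal (e powr p)"
      using AE_mean_measure
    proof eventually_elim
      case (elim h)
      then show ?case using close[of h] laguerre_norm_le_iff[OF p e] by simp
    qed
  qed
  also have "\<dots> = ennreal (e powr p)" by (simp add: emeasure_mean_measure_UNIV[OF \<alpha> \<delta>])
  finally show ?thesis using e by (subst laguerre_norm_le_iff[OF p]) auto
qed

section \<open>Compactness of the means\<close>

lemma floor_divide_eq_imp_close:
  fixes a b \<kappa> :: real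
  assumes "\<lfloor>a / \<kappa>\<rfloor> = \<lfloor>b / \<kappa>\<rfloor>" "0 < \<kappa>"
  shows "\<bar>a - b\<bar> \<le> \<kappa>"
proof -
  have "\<bar>a / \<kappa> - b / \<kappa>\<bar> \<le> 1" using assms(1) by linarith
  then have "\<bar>a - b\<bar> / \<kappa> \<le> 1" using assms(2) by (simp add: diff_divide_distrib[symmetric])
  then show ?thesis using assms(2) by simp
qed

text \<open>
  The values of a mean at the points of a fine grid of \<open>[0, R]\<close>, rounded to multiples of
  \<open>\<kappa>\<close>, are finitely many data because the means are uniformly bounded there. By
  equicontinuity they determine the mean on \<open>[0, R]\<close> up to \<open>3 \<kappa>\<close>, hence \<open>f\<close> itself in norm,
  since means approximate and tails are small. This pigeonhole argument replaces the extraction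
  of convergent subsequences.
\<close>

lemma finite_discretization:
  fixes S :: "(real \<Rightarrow> real) set"
  assumes p: "1 \<le> p" and \<alpha>: "0 \<le> \<alpha>" and b: "0 \<le> b"
    and borel: "\<And>f. f \<in> S \<Longrightarrow> f \<in> borel_measurable borel"
    and bound: "\<And>f. f \<in> S \<Longrightarrow> laguerre_norm p \<alpha> {0..} f \<le> ennreal b"
    and tails: "\<And>\<epsilon>. 0 < \<epsilon> \<Longrightarrow> \<exists>R>0. \<forall>f\<in>S. laguerre_norm p \<alpha> {R..} f \<le> ennreal \<epsilon>"
    and equicont: "\<And>\<epsilon> M. 0 < \<epsilon> \<Longrightarrow> 0 < M \<Longrightarrow> \<exists>\<delta>>0. \<forall>f\<in>S. \<forall>t h. 0 \<le> t \<and> t \<le> M \<and> 0 \<le> h \<and> h \<le> \<delta> \<longrightarrow>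
      laguerre_norm p \<alpha> {0..} (\<lambda>x. laguerre_translation \<alpha> (t + h) f x - laguerre_translation \<alpha> t f x) \<le> ennreal \<epsilon>"
    and e: "0 < e"
  obtains q :: "(real \<Rightarrow> real) \<Rightarrow> nat \<Rightarrow> int" where "finite (q ` S)"
    "\<And>f g. f \<in> S \<Longrightarrow> g \<in> S \<Longrightarrow> q f = q g \<Longrightarrow> laguerre_norm p \<alpha> {0..} (\<lambda>x. f x - g x) \<le> ennreal e"
proof -
  have \<alpha>': "- 1 / 2 < \<alpha>" using \<alpha> by simp
  \<comment> \<open>five errors: two approximations by means, two tails, and the difference of the means\<close>
  define d where "d = e / 5"
  have d: "0 < d" using e by (simp add: d_def)
  obtain R where R: "0 < R" "\<And>f. f \<in> S \<Longrightarrow> laguerre_norm p \<alpha> {R..} f \<le> ennreal d"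
    using tails[OF d] by blast
  obtain \<delta> where \<delta>: "0 < \<delta>" "\<And>f t h. \<lbrakk>f \<in> S; 0 \<le> t; t \<le> 1; 0 \<le> h; h \<le> \<delta>\<rbrakk> \<Longrightarrow>
      laguerre_norm p \<alpha> {0..} (\<lambda>x. laguerre_translation \<alpha> (t + h) f x - laguerre_translation \<alpha> t f x) \<le> ennreal d"
    using equicont[OF d zero_less_one] by blast
  define A where "A = laguerre_mean \<alpha> \<delta>"
  define C where "C = mean_const p \<alpha> \<delta>"
  have C: "0 < C" unfolding C_def using \<alpha> \<delta>(1) by (rule mean_const_pos)
  define D where "D = (R powr \<alpha> * R) powr (1 / p)"
  have D: "0 \<le> D" by (simp add: D_def)
  define \<kappa> where "\<kappa> = d / (3 * (D + 1))"
  have \<kappa>: "0 < \<kappa>" "3 * \<kappa> * D \<le> d" using d D by (auto simp: \<kappa>_def field_simps)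
  obtain \<eta> where \<eta>: "0 < \<eta>" "\<And>f t h. \<lbrakk>f \<in> S; 0 \<le> t; t \<le> R; 0 \<le> h; h \<le> \<eta>\<rbrakk> \<Longrightarrow>
      laguerre_norm p \<alpha> {0..} (\<lambda>x. laguerre_translation \<alpha> (t + h) f x - laguerre_translation \<alpha> t f x) \<le> ennreal (\<kappa> / C)"
    using equicont[of "\<kappa> / C" R] \<kappa> C R(1) by (metis divide_pos_pos)
  define N where "N = nat \<lceil>R / \<eta>\<rceil>"
  define q where "q f i = (if i \<in> {..N} then \<lfloor>A f (real i * \<eta>) / \<kappa>\<rfloor> else 0)" for f and i :: nat
  have fin: "laguerre_norm p \<alpha> {0..} f < \<infinity>" if "f \<in> S" for f
    using bound[OF that] by (rule le_less_trans) simp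
  \<comment> \<open>every point of \<open>[0, R]\<close> lies within \<open>\<eta>\<close> to the right of a grid point\<close>
  have A_grid: "\<bar>A f x - A f (real (nat \<lfloor>x / \<eta>\<rfloor>) * \<eta>)\<bar> \<le> \<kappa>" if f: "f \<in> S" and x: "0 \<le> x" "x \<le> R" for f x
  proof -
    define y where "y = real (nat \<lfloor>x / \<eta>\<rfloor>) * \<eta>"
    have i: "real (nat \<lfloor>x / \<eta>\<rfloor>) = of_int \<lfloor>x / \<eta>\<rfloor>" using x \<eta>(1) by simp
    have "of_int \<lfloor>x / \<eta>\<rfloor> \<le> x / \<eta>" "x / \<eta> \<le> of_int \<lfloor>x / \<eta>\<rfloor> + 1" by linarith+
    then have "of_int \<lfloor>x / \<eta>\<rfloor> * \<eta> \<le> x / \<eta> * \<eta>" "x / \<eta> * \<eta> \<le> (of_int \<lfloor>x / \<eta>\<rfloor> + 1) * \<eta>"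
      using \<eta>(1) by (auto intro!: mult_right_mono simp del: nonzero_divide_eq_eq times_divide_eq_left)
    then have y: "y \<le> x" "x \<le> y + \<eta>"
      unfolding y_def i using \<eta>(1) by (auto simp: distrib_right)
    have y0: "0 \<le> y" using \<eta>(1) by (simp add: y_def)
    have "laguerre_norm p \<alpha> {0..} (\<lambda>h. laguerre_translation \<alpha> (y + (x - y)) f h - laguerre_translation \<alpha> y f h) \<le> ennreal (\<kappa> / C)"
      using y y0 x by (intro \<eta>(2) f) auto
    then have "\<bar>A f x - A f y\<bar> \<le> C * (\<kappa> / C)"
      unfolding A_def C_def[symmetric] using \<kappa> C x y0
      by (subst C_def, intro laguerre_mean_diff_le[OF p \<alpha> \<delta>(1) borel[OF f] fin[OF f]]) auto
    then show ?thesis using C by (simp add: y_def)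
  qed
  have close: "laguerre_norm p \<alpha> {0..} (\<lambda>x. A f x - f x) \<le> ennreal d" if f: "f \<in> S" for f
    unfolding A_def
  proof (rule laguerre_mean_approximates[OF p \<alpha> \<delta>(1) borel[OF f] fin[OF f] less_imp_le[OF d]])
    fix h assume "0 \<le> h" "h \<le> \<delta>"
    then show "laguerre_norm p \<alpha> {0..} (\<lambda>x. laguerre_translation \<alpha> h f x - f x) \<le> ennreal d"
      using \<delta>(2)[OF f, of 0 h] by (simp add: laguerre_translation_0[OF \<alpha>' borel[OF f]])
  qed
  show ?thesis
  proof (rule that[of q])
    define B where "B = C * (exp (real N * \<eta> / 2) * b)"
    define L where "L = \<lceil>B / \<kappa>\<rceil> + 1"
    have "q f i \<in> {- L..L}" if "f \<in> S" "i \<in> {..N}" for f i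
    proof -
      have "\<bar>A f (real i * \<eta>)\<bar> \<le> C * (exp (real i * \<eta> / 2) * b)"
        unfolding A_def C_def using \<eta>(1) by (intro laguerre_mean_abs_le[OF p \<alpha> \<delta>(1) borel b bound] that) auto
      also have "\<dots> \<le> B"
        unfolding B_def using that(2) \<eta>(1) C b by (intro mult_left_mono mult_right_mono) auto
      finally have "\<bar>A f (real i * \<eta>)\<bar> / \<kappa> \<le> B / \<kappa>" using \<kappa>(1) by (intro divide_right_mono) auto
      then have "\<bar>A f (real i * \<eta>) / \<kappa>\<bar> \<le> B / \<kappa>" using \<kappa>(1) by simp
      moreover have "\<lfloor>z\<rfloor> \<in> {- L..L}" if "\<bar>z\<bar> \<le> B / \<kappa>" for z
        using that unfolding L_def atLeastAtMost_iff abs_le_iff by linarith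
      ultimately show ?thesis using that(2) by (simp add: q_def)
    qed
    then have "q ` S \<subseteq> {g. \<forall>i. (i \<in> {..N} \<longrightarrow> g i \<in> {- L..L}) \<and> (i \<notin> {..N} \<longrightarrow> g i = 0)}"
      by (auto simp: q_def)
    moreover have "finite \<dots>" by (rule finite_set_of_finite_funs) auto
    ultimately show "finite (q ` S)" by (rule finite_subset)
  next
    fix f g assume f: "f \<in> S" and g: "g \<in> S" and eq: "q f = q g"
    have A_close: "\<bar>A f x - A g x\<bar> \<le> 3 * \<kappa>" if x: "0 \<le> x" "x \<le> R" for x
    proof -
      define i where "i = nat \<lfloor>x / \<eta>\<rfloor>"
      have "x / \<eta> \<le> R / \<eta>" using x \<eta>(1) by (intro divide_right_mono) auto
      then have "i \<in> {..N}" unfolding i_def N_def by simp linarith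
      then have "\<lfloor>A f (real i * \<eta>) / \<kappa>\<rfloor> = \<lfloor>A g (real i * \<eta>) / \<kappa>\<rfloor>"
        using fun_cong[OF eq, of i] by (simp add: q_def)
      then have "\<bar>A f (real i * \<eta>) - A g (real i * \<eta>)\<bar> \<le> \<kappa>"
        using \<kappa>(1) by (rule floor_divide_eq_imp_close)
      then show ?thesis using A_grid[OF f x] A_grid[OF g x] unfolding i_def by linarith
    qed
    have [measurable]: "f \<in> borel_measurable borel" "g \<in> borel_measurable borel" using f g borel by auto
    have [measurable]: "A f \<in> borel_measurable borel" "A g \<in> borel_measurable borel"
      unfolding A_def by (intro borel_measurable_laguerre_mean[OF \<alpha> \<delta>(1)], measurable)+
    define m where "m x = indicator {..R} x * (A f x - A g x)" for x
    define tf tg where "tf x = indicator {R..} x * f x" and "tg x = indicator {R..} x * g x" for x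
    have [measurable]: "m \<in> borel_measurable borel" "tf \<in> borel_measurable borel" "tg \<in> borel_measurable borel"
      unfolding m_def[abs_def] tf_def[abs_def] tg_def[abs_def] by measurable
    have "laguerre_norm p \<alpha> {0..} m \<le> ennreal (3 * \<kappa> * (R powr \<alpha> * R) powr (1 / p))"
      using \<kappa>(1) R(1) A_close by (intro laguerre_norm_le_of_bounded_support[OF p \<alpha>]) (auto simp: m_def)
    also have "\<dots> \<le> ennreal d" using \<kappa>(2) by (intro ennreal_leI) (simp add: D_def)
    finally have m: "laguerre_norm p \<alpha> {0..} m \<le> ennreal d" .
    have tail: "laguerre_norm p \<alpha> {0..} (\<lambda>x. indicator {R..} x * k x) \<le> ennreal d" if "k \<in> S" for k
    proof -
      have "laguerre_norm p \<alpha> {0..} (\<lambda>x. indicator {R..} x * k x) = laguerre_norm p \<alpha> {R..} k"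
      proof -
        have "(\<integral>\<^sup>+x\<in>{0..}. ennreal (\<bar>indicator {R..} x * k x * exp (- x / 2)\<bar> powr p * x powr \<alpha>) \<partial>lborel) =
            (\<integral>\<^sup>+x\<in>{R..}. ennreal (\<bar>k x * exp (- x / 2)\<bar> powr p * x powr \<alpha>) \<partial>lborel)"
          using R(1) p by (intro nn_integral_cong) (auto simp: indicator_def)
        then show ?thesis by (simp add: laguerre_norm_def)
      qed
      then show ?thesis using R(2)[OF that] by simp
    qed
    have "laguerre_norm p \<alpha> {0..} (\<lambda>x. f x - g x) \<le>
        laguerre_norm p \<alpha> {0..} (\<lambda>x. \<bar>A f x - f x\<bar> + (\<bar>A g x - g x\<bar> + (\<bar>m x\<bar> + (\<bar>tf x\<bar> + \<bar>tg x\<bar>))))"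
    proof (rule laguerre_norm_mono[OF p])
      fix x :: real assume x: "x \<in> {0..}"
      show "x \<in> {0..} \<and> \<bar>f x - g x\<bar> \<le> \<bar>\<bar>A f x - f x\<bar> + (\<bar>A g x - g x\<bar> + (\<bar>m x\<bar> + (\<bar>tf x\<bar> + \<bar>tg x\<bar>)))\<bar>"
        using x by (cases "x \<le> R") (auto simp: m_def tf_def tg_def indicator_def)
    qed
    also have "\<dots> \<le> ennreal (d + (d + (d + (d + d))))"
    proof -
      have abs: "laguerre_norm p \<alpha> {0..} (\<lambda>x. \<bar>k x\<bar>) = laguerre_norm p \<alpha> {0..} k" for k
        by (simp add: laguerre_norm_def abs_mult)
      show ?thesis
        using d f g m close tail unfolding tf_def tg_def
        by (intro laguerre_norm_add_le'[OF p]) (auto simp: abs)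
    qed
    also have "d + (d + (d + (d + d))) = e" by (simp add: d_def)
    finally show "laguerre_norm p \<alpha> {0..} (\<lambda>x. f x - g x) \<le> ennreal e" .
  qed
qed

section \<open>Representatives of classes\<close>

text \<open>
  The members of a class are measurable only on the half line, and the extension by zero is
  measurable everywhere. No norm over the half line and no translation at nonnegative arguments
  sees the difference.
\<close>

definition borel_rep :: "(real \<Rightarrow> real) \<Rightarrow> real \<Rightarrow> real" where
  "borel_rep f x = indicator {0..} x * f x"

lemma borel_measurable_borel_rep: "f \<in> laguerre_functions p \<alpha> \<Longrightarrow> borel_rep f \<in> borel_measurable borel"
  by (simp add: laguerre_functions_def set_borel_measurable_def borel_rep_def[abs_def])

lemma borel_rep_eq: "0 \<le> x \<Longrightarrow> borel_rep f x = f x"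
  by (simp add: borel_rep_def)

lemma laguerre_translation_borel_rep:
  assumes "0 \<le> t" "0 \<le> x"
  shows "laguerre_translation \<alpha> t (borel_rep f) x = laguerre_translation \<alpha> t f x"
  unfolding laguerre_translation_def
  by (simp only: borel_rep_eq[OF translation_argument_nonneg[OF assms(2,1)]])

lemma laguerre_norm_translation_diff_borel_rep:
  assumes "0 \<le> s" "0 \<le> t"
  shows "laguerre_norm p \<alpha> {0..} (\<lambda>x. laguerre_translation \<alpha> s (borel_rep f) x - laguerre_translation \<alpha> t (borel_rep f) x) =
    laguerre_norm p \<alpha> {0..} (\<lambda>x. laguerre_translation \<alpha> s f x - laguerre_translation \<alpha> t f x)"
  using assms by (intro laguerre_norm_cong) (simp add: laguerre_translation_borel_rep)

lemma laguerre_Lp_imp_functions: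
  assumes "F \<in> laguerre_Lp p \<alpha>" "f \<in> F"
  shows "f \<in> laguerre_functions p \<alpha>"
  using assms in_quotient_imp_subset[OF equiv_laguerre_rel] by (auto simp: laguerre_Lp_def)

text \<open>
  The distance is defined through chosen representatives; any others differ from them on a null
  set of the half line only.
\<close>

lemma laguerre_norm_diff_eq_dist:
  assumes p: "1 \<le> p" and F: "F \<in> laguerre_Lp p \<alpha>" "f \<in> F" and G: "G \<in> laguerre_Lp p \<alpha>" "g \<in> G"
  shows "laguerre_norm p \<alpha> {0..} (\<lambda>x. f x - g x) = ennreal (laguerre_dist p \<alpha> F G)"
proof -
  define f' g' where "f' = (SOME f. f \<in> F)" and "g' = (SOME f. f \<in> G)"
  have f': "f' \<in> F" "f' \<in> laguerre_functions p \<alpha>" unfolding f'_def using F by (auto intro: laguerre_Lp_some)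
  have g': "g' \<in> G" "g' \<in> laguerre_functions p \<alpha>" unfolding g'_def using G by (auto intro: laguerre_Lp_some)
  have "(f, f') \<in> laguerre_rel p \<alpha>" "(g, g') \<in> laguerre_rel p \<alpha>"
    using in_quotient_imp_in_rel[OF equiv_laguerre_rel] F G f' g' by (auto simp: laguerre_Lp_def)
  then have "AE x in lborel. 0 \<le> x \<longrightarrow> f x = f' x" "AE x in lborel. 0 \<le> x \<longrightarrow> g x = g' x"
    by (auto simp: laguerre_rel_def)
  then have "AE x in lborel. x \<in> {0..} \<longrightarrow> f x - g x = f' x - g' x" by eventually_elim auto
  then have "laguerre_norm p \<alpha> {0..} (\<lambda>x. f x - g x) = laguerre_norm p \<alpha> {0..} (\<lambda>x. f' x - g' x)"
    by (rule laguerre_norm_cong_AE)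
  also have "\<dots> = ennreal (laguerre_dist p \<alpha> F G)"
    using laguerre_functions_diff[OF p f'(2) g'(2)]
    unfolding laguerre_dist_def Let_def f'_def[symmetric] g'_def[symmetric]
    by (simp add: laguerre_functions_def)
  finally show ?thesis .
qed

lemma laguerre_norm_borel_rep: "laguerre_norm p \<alpha> {0..} (borel_rep f) = laguerre_norm p \<alpha> {0..} f"
  by (rule laguerre_norm_cong) (simp add: borel_rep_eq)

lemma laguerre_norm_borel_rep_diff:
  "laguerre_norm p \<alpha> {0..} (\<lambda>x. borel_rep f x - borel_rep g x) = laguerre_norm p \<alpha> {0..} (\<lambda>x. f x - g x)"
  by (rule laguerre_norm_cong) (simp add: borel_rep_eq)

lemma laguerre_norm_borel_rep_finite:
  "f \<in> laguerre_functions p \<alpha> \<Longrightarrow> laguerre_norm p \<alpha> {0..} (borel_rep f) < \<infinity>"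
  by (simp add: laguerre_norm_borel_rep laguerre_functions_def)

lemma laguerre_functions_set_borel_measurable:
  "f \<in> laguerre_functions p \<alpha> \<Longrightarrow> set_borel_measurable lborel {0..} f"
  by (simp add: laguerre_functions_def)

section \<open>Total boundedness\<close>

lemma finite_common_threshold:
  fixes P :: "'a \<Rightarrow> real \<Rightarrow> bool"
  assumes "finite X" "\<And>x. x \<in> X \<Longrightarrow> \<exists>\<delta>>0. P x \<delta>" "\<And>x \<delta> \<delta>'. P x \<delta> \<Longrightarrow> 0 < \<delta>' \<Longrightarrow> \<delta>' \<le> \<delta> \<Longrightarrow> P x \<delta>'"
  shows "\<exists>\<delta>>0. \<forall>x\<in>X. P x \<delta>"
proof -
  obtain d where d: "\<And>x. x \<in> X \<Longrightarrow> 0 < d x \<and> P x (d x)" using assms(2) by metis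
  define m where "m = Min (insert 1 (d ` X))"
  have m: "0 < m" using assms(1) d by (auto simp: m_def Min_gr_iff)
  have "P x m" if "x \<in> X" for x
  proof (rule assms(3))
    show "P x (d x)" using d that by blast
    show "m \<le> d x" unfolding m_def using assms(1) that by (intro Min_le) auto
  qed (rule m)
  with m show ?thesis by blast
qed

lemma laguerre_norm_tail:
  assumes p: "1 \<le> p" and f: "f \<in> laguerre_functions p \<alpha>" and e: "0 < e"
  shows "\<exists>R>0. laguerre_norm p \<alpha> {R..} f \<le> ennreal e"
proof -
  have [measurable]: "borel_rep f \<in> borel_measurable borel" using f by (rule borel_measurable_borel_rep)
  have "\<exists>n::nat. laguerre_norm p \<alpha> {0..} (\<lambda>x. indicator {real n + 1..} x * borel_rep f x) \<le> ennreal e"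
  proof (rule laguerre_norm_dominated_convergence[OF p, where w = "borel_rep f"])
    have "laguerre_norm p \<alpha> {0..} (borel_rep f) = laguerre_norm p \<alpha> {0..} f"
      by (rule laguerre_norm_cong) (simp add: borel_rep_eq)
    then show "laguerre_norm p \<alpha> {0..} (borel_rep f) < \<infinity>" using f by (simp add: laguerre_functions_def)
    show "AE x in lborel. 0 \<le> x \<longrightarrow> (\<lambda>n. indicator {real n + 1..} x * borel_rep f x) \<longlonglongrightarrow> 0"
    proof (intro AE_I2 impI tendsto_eventually)
      fix x :: real
      show "\<forall>\<^sub>F n in sequentially. indicator {real n + 1..} x * borel_rep f x = 0"
        using eventually_ge_at_top[of "nat \<lceil>x\<rceil>"]
        by eventually_elim (auto simp: indicator_def)
    qed
  qed (use e in \<open>auto simp: indicator_def\<close>)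
  then obtain n :: nat where n: "laguerre_norm p \<alpha> {0..} (\<lambda>x. indicator {real n + 1..} x * borel_rep f x) \<le> ennreal e" ..
  have "laguerre_norm p \<alpha> {real n + 1..} f \<le> laguerre_norm p \<alpha> {0..} (\<lambda>x. indicator {real n + 1..} x * borel_rep f x)"
    by (rule laguerre_norm_mono[OF p]) (auto simp: borel_rep_eq)
  then show ?thesis using n by (intro exI[of _ "real n + 1"]) auto
qed

text \<open>
  A net for the classes, transported to functions: \<open>r\<close> assigns to every representative of every
  class a nearby function of the net.
\<close>

lemma mtotally_bounded_imp_finite_net:
  assumes p: "1 \<le> p" and K: "K \<subseteq> laguerre_Lp p \<alpha>"
    and tb: "Metric_space.mtotally_bounded (laguerre_Lp p \<alpha>) (laguerre_dist p \<alpha>) K" and e: "0 < e"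
  obtains X r where "finite X" "X \<subseteq> laguerre_functions p \<alpha>" "\<And>f. f \<in> \<Union>K \<Longrightarrow> r f \<in> X"
    "\<And>f. f \<in> \<Union>K \<Longrightarrow> laguerre_norm p \<alpha> {0..} (\<lambda>x. f x - r f x) \<le> ennreal e"
proof -
  interpret Metric_space "laguerre_Lp p \<alpha>" "laguerre_dist p \<alpha>" by (rule Metric_space_laguerre[OF p])
  have "\<exists>Y. finite Y \<and> Y \<subseteq> K \<and> K \<subseteq> (\<Union>G\<in>Y. mball G e)"
    using tb e unfolding mtotally_bounded_def by simp
  then obtain Y where Y: "finite Y" "Y \<subseteq> K" "K \<subseteq> (\<Union>G\<in>Y. mball G e)"
    by (elim exE conjE)
  define c where "c G = (SOME g. g \<in> G)" for G :: "(real \<Rightarrow> real) set"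
  have c: "c G \<in> G" "c G \<in> laguerre_functions p \<alpha>" if "G \<in> Y" for G
  proof -
    have "G \<in> laguerre_Lp p \<alpha>" using that Y(2) K by blast
    then show "c G \<in> G" "c G \<in> laguerre_functions p \<alpha>" unfolding c_def by (rule laguerre_Lp_some)+
  qed
  have ex: "\<exists>g\<in>c ` Y. laguerre_norm p \<alpha> {0..} (\<lambda>x. f x - g x) \<le> ennreal e" if f: "f \<in> \<Union>K" for f
  proof -
    obtain F where F: "F \<in> K" "f \<in> F" using f by blast
    obtain G where "G \<in> Y" "F \<in> mball G e" using F(1) Y(3) by blast
    then have G: "G \<in> Y" "laguerre_dist p \<alpha> G F < e" by (simp_all add: in_mball)
    have "laguerre_norm p \<alpha> {0..} (\<lambda>x. f x - c G x) = ennreal (laguerre_dist p \<alpha> F G)"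
    proof (rule laguerre_norm_diff_eq_dist[OF p _ F(2) _ c(1)[OF G(1)]])
      show "F \<in> laguerre_Lp p \<alpha>" "G \<in> laguerre_Lp p \<alpha>" using F(1) G(1) Y(2) K by blast+
    qed
    also have "\<dots> \<le> ennreal e" using G(2) by (intro ennreal_leI) (simp add: commute[of F G])
    finally show ?thesis using G(1) by blast
  qed
  obtain r where r: "\<forall>f\<in>\<Union>K. r f \<in> c ` Y \<and> laguerre_norm p \<alpha> {0..} (\<lambda>x. f x - r f x) \<le> ennreal e"
    using ex by metis
  show ?thesis
  proof (rule that[of "c ` Y" r])
    show "c ` Y \<subseteq> laguerre_functions p \<alpha>" using c(2) by (rule image_subsetI)
  qed (use Y(1) bspec[OF r] in simp_all)
qed

lemma mtotally_bounded_imp_uniform_tails: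
  assumes p: "1 \<le> p" and K: "K \<subseteq> laguerre_Lp p \<alpha>"
    and tb: "Metric_space.mtotally_bounded (laguerre_Lp p \<alpha>) (laguerre_dist p \<alpha>) K" and e: "0 < e"
  shows "\<exists>R>0. \<forall>f\<in>\<Union>K. laguerre_norm p \<alpha> {R..} f < ennreal e"
proof -
  define d where "d = e / 3"
  have d: "0 < d" using e by (simp add: d_def)
  obtain X r where X: "finite X" "X \<subseteq> laguerre_functions p \<alpha>" and rX: "\<And>f. f \<in> \<Union>K \<Longrightarrow> r f \<in> X"
    and r: "\<And>f. f \<in> \<Union>K \<Longrightarrow> laguerre_norm p \<alpha> {0..} (\<lambda>x. f x - r f x) \<le> ennreal d"
    by (rule mtotally_bounded_imp_finite_net[OF p K tb d]) (rule that)
  \<comment> \<open>a common \<open>R\<close> for the net is the reciprocal of a common positive \<open>\<rho>\<close>\<close>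
  have "\<exists>\<rho>>0. \<forall>g\<in>X. laguerre_norm p \<alpha> {1 / \<rho>..} g \<le> ennreal d"
  proof (rule finite_common_threshold[OF X(1)])
    fix g assume "g \<in> X"
    then obtain R where "R > 0" "laguerre_norm p \<alpha> {R..} g \<le> ennreal d"
      using laguerre_norm_tail[OF p, of g \<alpha> d] X(2) d by auto
    then show "\<exists>\<rho>>0. laguerre_norm p \<alpha> {1 / \<rho>..} g \<le> ennreal d"
      by (intro exI[of _ "1 / R"]) auto
  next
    fix g \<rho> \<rho>' assume *: "laguerre_norm p \<alpha> {1 / \<rho>..} g \<le> ennreal d" "0 < \<rho>'" "\<rho>' \<le> \<rho>"
    then have "1 / \<rho> \<le> 1 / \<rho>'" by (simp add: frac_le)
    then have "laguerre_norm p \<alpha> {1 / \<rho>'..} g \<le> laguerre_norm p \<alpha> {1 / \<rho>..} g"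
      by (intro laguerre_norm_mono[OF p]) auto
    then show "laguerre_norm p \<alpha> {1 / \<rho>'..} g \<le> ennreal d" using * by simp
  qed
  then obtain \<rho> where \<rho>: "0 < \<rho>" "\<And>g. g \<in> X \<Longrightarrow> laguerre_norm p \<alpha> {1 / \<rho>..} g \<le> ennreal d" by blast
  have "laguerre_norm p \<alpha> {1 / \<rho>..} f < ennreal e" if f: "f \<in> \<Union>K" for f
  proof -
    have fr: "f \<in> laguerre_functions p \<alpha>" "r f \<in> laguerre_functions p \<alpha>"
      using f laguerre_Lp_imp_functions K rX[OF f] X(2) by blast+
    have sub: "set_borel_measurable lborel {1 / \<rho>..} k" if "k \<in> laguerre_functions p \<alpha>" for k
      using set_borel_measurable_subset[OF laguerre_functions_set_borel_measurable[OF that], of "{1 / \<rho>..}"] \<rho>(1)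
      by auto
    have "laguerre_norm p \<alpha> {1 / \<rho>..} (\<lambda>x. f x - r f x) \<le> laguerre_norm p \<alpha> {0..} (\<lambda>x. f x - r f x)"
    proof (rule laguerre_norm_mono[OF p])
      have "0 < 1 / \<rho>" using \<rho>(1) by simp
      then show "x \<in> {0..} \<and> \<bar>f x - r f x\<bar> \<le> \<bar>f x - r f x\<bar>" if "x \<in> {1 / \<rho>..}" for x
        using that unfolding atLeast_iff by linarith
    qed
    also have "\<dots> \<le> ennreal d" using f by (rule r)
    finally have "laguerre_norm p \<alpha> {1 / \<rho>..} (\<lambda>x. (f x - r f x) + r f x) \<le> ennreal (d + d)"
      using d sub[OF laguerre_functions_diff[OF p fr]] sub[OF fr(2)] \<rho>(2)[OF rX[OF f]]
      by (intro laguerre_norm_add_le[OF p]) auto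
    also have "\<dots> < ennreal e" using e by (intro ennreal_lessI) (auto simp: d_def)
    finally show ?thesis by simp
  qed
  then show ?thesis using \<rho>(1) by (intro exI[of _ "1 / \<rho>"]) auto
qed

text \<open>
  The translations by bounded parameters are uniformly bounded operators, so continuity for the
  finitely many functions of a net is equicontinuity for the whole set.
\<close>

lemma mtotally_bounded_imp_equicontinuous_translates:
  assumes p: "1 \<le> p" and \<alpha>: "0 \<le> \<alpha>" and K: "K \<subseteq> laguerre_Lp p \<alpha>"
    and tb: "Metric_space.mtotally_bounded (laguerre_Lp p \<alpha>) (laguerre_dist p \<alpha>) K" and e: "0 < e" and M: "0 < M"
  shows "\<exists>\<delta>>0. \<forall>t h. 0 \<le> t \<and> t \<le> M \<and> 0 \<le> h \<and> h \<le> \<delta> \<longrightarrow> (\<forall>f\<in>\<Union>K.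
    laguerre_norm p \<alpha> {0..} (\<lambda>x. laguerre_translation \<alpha> (t + h) f x - laguerre_translation \<alpha> t f x) < ennreal e)"
proof -
  have \<alpha>': "- 1 / 2 < \<alpha>" using \<alpha> by simp
  define d where "d = e / 4"
  have d: "0 < d" using e by (simp add: d_def)
  define E where "E = exp ((M + 1) / 2)"
  have E: "0 < E" by (simp add: E_def)
  obtain X r where X: "finite X" "X \<subseteq> laguerre_functions p \<alpha>" and rX: "\<And>f. f \<in> \<Union>K \<Longrightarrow> r f \<in> X"
    and r: "\<And>f. f \<in> \<Union>K \<Longrightarrow> laguerre_norm p \<alpha> {0..} (\<lambda>x. f x - r f x) \<le> ennreal (d / E)"
    by (rule mtotally_bounded_imp_finite_net[OF p K tb divide_pos_pos[OF d E]]) (rule that)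
  let ?T = "\<lambda>t f. laguerre_translation \<alpha> t (borel_rep f)"
  have "\<exists>\<delta>>0. \<forall>g\<in>X. \<delta> \<le> 1 \<and> (\<forall>t h. 0 \<le> t \<and> t \<le> M \<and> 0 \<le> h \<and> h \<le> \<delta> \<longrightarrow>
      laguerre_norm p \<alpha> {0..} (\<lambda>x. ?T (t + h) g x - ?T t g x) \<le> ennreal d)"
  proof (rule finite_common_threshold[OF X(1)])
    fix g assume "g \<in> X"
    then have g: "g \<in> laguerre_functions p \<alpha>" using X(2) by blast
    show "\<exists>\<delta>>0. \<delta> \<le> 1 \<and> (\<forall>t h. 0 \<le> t \<and> t \<le> M \<and> 0 \<le> h \<and> h \<le> \<delta> \<longrightarrow>
        laguerre_norm p \<alpha> {0..} (\<lambda>x. ?T (t + h) g x - ?T t g x) \<le> ennreal d)"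
      by (rule laguerre_translation_uniformly_continuous[OF p \<alpha> borel_measurable_borel_rep[OF g]
          laguerre_norm_borel_rep_finite[OF g] less_imp_le[OF M] d]) blast
  qed auto
  then obtain \<delta> where \<delta>: "0 < \<delta>" and \<delta>X: "\<And>g. g \<in> X \<Longrightarrow> \<delta> \<le> 1"
      "\<And>g t h. \<lbrakk>g \<in> X; 0 \<le> t; t \<le> M; 0 \<le> h; h \<le> \<delta>\<rbrakk> \<Longrightarrow>
        laguerre_norm p \<alpha> {0..} (\<lambda>x. ?T (t + h) g x - ?T t g x) \<le> ennreal d" by blast
  have "laguerre_norm p \<alpha> {0..} (\<lambda>x. laguerre_translation \<alpha> (t + h) f x - laguerre_translation \<alpha> t f x) < ennreal e"
    if th: "0 \<le> t" "t \<le> M" "0 \<le> h" "h \<le> \<delta>" and f: "f \<in> \<Union>K" for t h f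
  proof -
    have fr: "f \<in> laguerre_functions p \<alpha>" "r f \<in> laguerre_functions p \<alpha>"
      using f laguerre_Lp_imp_functions K rX[OF f] X(2) by blast+
    note b = borel_measurable_borel_rep[OF fr(1)] borel_measurable_borel_rep[OF fr(2)]
    have [measurable]: "?T s f \<in> borel_measurable borel" "?T s (r f) \<in> borel_measurable borel" for s
      using b by (auto intro: borel_measurable_laguerre_translation_right[OF \<alpha>'])
    have approx: "laguerre_norm p \<alpha> {0..} (\<lambda>x. ?T s f x - ?T s (r f) x) \<le> ennreal d"
      if s: "0 \<le> s" "s \<le> M + 1" for s
    proof -
      have "laguerre_norm p \<alpha> {0..} (\<lambda>x. ?T s f x - ?T s (r f) x) \<le> ennreal (exp (s / 2) * (d / E))"
        using d E r[OF f]
        by (intro laguerre_translation_diff_norm_le[OF p \<alpha> s(1) b(1) laguerre_norm_borel_rep_finite[OF fr(1)]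
              b(2) laguerre_norm_borel_rep_finite[OF fr(2)]])
           (auto simp: laguerre_norm_borel_rep_diff)
      also have "\<dots> \<le> ennreal (E * (d / E))"
        using s d E by (intro ennreal_leI mult_right_mono) (auto simp: E_def)
      finally show ?thesis using E by simp
    qed
    have 3: "laguerre_norm p \<alpha> {0..} (\<lambda>x. ?T t (r f) x - ?T t f x) \<le> ennreal d"
      using approx[of t] th by (subst laguerre_norm_minus_commute) auto
    have "laguerre_norm p \<alpha> {0..} (\<lambda>x. (?T (t + h) f x - ?T (t + h) (r f) x) +
        ((?T (t + h) (r f) x - ?T t (r f) x) + (?T t (r f) x - ?T t f x))) \<le> ennreal (d + (d + d))"
      using th d \<delta>X(1)[OF rX[OF f]]
      by (intro laguerre_norm_add_le'[OF p] approx 3 \<delta>X(2)[OF rX[OF f]]) auto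
    also have "\<dots> < ennreal e" using e by (intro ennreal_lessI) (auto simp: d_def)
    finally show ?thesis
      using th by (simp add: laguerre_norm_translation_diff_borel_rep)
  qed
  then show ?thesis using \<delta> by blast
qed

text \<open>
  One class from each cell of the finite discretization gives a net that is contained in \<open>K\<close>.
\<close>

lemma mtotally_bounded_if_tails_and_equicontinuous_translates:
  assumes p: "1 \<le> p" and \<alpha>: "0 \<le> \<alpha>" and K: "K \<subseteq> laguerre_Lp p \<alpha>"
    and bd: "Metric_space.mbounded (laguerre_Lp p \<alpha>) (laguerre_dist p \<alpha>) K"
    and tails: "\<And>\<epsilon>. 0 < \<epsilon> \<Longrightarrow> \<exists>R>0. \<forall>f\<in>\<Union>K. laguerre_norm p \<alpha> {R..} f < ennreal \<epsilon>"
    and equicont: "\<And>\<epsilon> M. 0 < \<epsilon> \<Longrightarrow> 0 < M \<Longrightarrow> \<exists>\<delta>>0. \<forall>t h. 0 \<le> t \<and> t \<le> M \<and> 0 \<le> h \<and> h \<le> \<delta> \<longrightarrow> (\<forall>f\<in>\<Union>K.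
      laguerre_norm p \<alpha> {0..} (\<lambda>x. laguerre_translation \<alpha> (t + h) f x - laguerre_translation \<alpha> t f x) < ennreal \<epsilon>)"
  shows "Metric_space.mtotally_bounded (laguerre_Lp p \<alpha>) (laguerre_dist p \<alpha>) K"
proof -
  interpret Metric_space "laguerre_Lp p \<alpha>" "laguerre_dist p \<alpha>" by (rule Metric_space_laguerre[OF p])
  define c where "c F = (SOME f. f \<in> F)" for F :: "(real \<Rightarrow> real) set"
  have c: "c F \<in> F" "c F \<in> laguerre_functions p \<alpha>" "c F \<in> \<Union>K" if "F \<in> K" for F
  proof -
    have "F \<in> laguerre_Lp p \<alpha>" using that K by blast
    then show "c F \<in> F" "c F \<in> laguerre_functions p \<alpha>" unfolding c_def by (rule laguerre_Lp_some)+
    with that show "c F \<in> \<Union>K" by blast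
  qed
  have dist: "laguerre_norm p \<alpha> {0..} (\<lambda>x. c F x - c G x) = ennreal (laguerre_dist p \<alpha> F G)"
    if "F \<in> K" "G \<in> K" for F G
    using that K by (intro laguerre_norm_diff_eq_dist[OF p _ c(1) _ c(1)]) blast+
  define S where "S = (\<lambda>F. borel_rep (c F)) ` K"
  have S: "\<exists>F\<in>K. f = borel_rep (c F)" if "f \<in> S" for f using that by (auto simp: S_def)
  obtain b where b: "0 \<le> b" "\<And>f. f \<in> S \<Longrightarrow> laguerre_norm p \<alpha> {0..} f \<le> ennreal b"
  proof (cases "K = {}")
    case True
    then show ?thesis using that[of 0] by (simp add: S_def)
  next
    case False
    then obtain G where G: "G \<in> K" by blast
    obtain B where B: "\<And>F. F \<in> K \<Longrightarrow> laguerre_dist p \<alpha> F G \<le> B"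
      using bd G unfolding mbounded_alt by blast
    obtain a where a: "0 \<le> a" "laguerre_norm p \<alpha> {0..} (c G) = ennreal a"
      using c(2)[OF G] by (cases "laguerre_norm p \<alpha> {0..} (c G)") (auto simp: laguerre_functions_def)
    have B0: "0 \<le> B" using B[OF G] nonneg[of G G] by linarith
    show ?thesis
    proof (rule that[of "B + a"])
      fix f assume "f \<in> S"
      then obtain F where F: "F \<in> K" "f = borel_rep (c F)" using S by blast
      have "laguerre_norm p \<alpha> {0..} (\<lambda>x. c F x - c G x) \<le> ennreal B"
        unfolding dist[OF F(1) G] using B[OF F(1)] by (rule ennreal_leI)
      then have "laguerre_norm p \<alpha> {0..} (\<lambda>x. (c F x - c G x) + c G x) \<le> ennreal (B + a)"
        using a B0 laguerre_functions_diff[OF p c(2)[OF F(1)] c(2)[OF G]] c(2)[OF G]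
        by (intro laguerre_norm_add_le[OF p]) (auto intro: laguerre_functions_set_borel_measurable)
      then show "laguerre_norm p \<alpha> {0..} f \<le> ennreal (B + a)" by (simp add: F laguerre_norm_borel_rep)
    qed (use a B0 in auto)
  qed
  show ?thesis
    unfolding mtotally_bounded_def
  proof (intro allI impI)
    fix e :: real assume e: "0 < e"
    obtain q :: "(real \<Rightarrow> real) \<Rightarrow> nat \<Rightarrow> int" where q: "finite (q ` S)"
      "\<And>f g. f \<in> S \<Longrightarrow> g \<in> S \<Longrightarrow> q f = q g \<Longrightarrow> laguerre_norm p \<alpha> {0..} (\<lambda>x. f x - g x) \<le> ennreal (e / 2)"
    proof (rule finite_discretization[OF p \<alpha> b(1), of S "e / 2"])
      fix \<epsilon> :: real assume "0 < \<epsilon>"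
      then obtain R where R: "0 < R" "\<forall>f\<in>\<Union>K. laguerre_norm p \<alpha> {R..} f < ennreal \<epsilon>"
        using tails by meson
      have "laguerre_norm p \<alpha> {R..} (borel_rep f) = laguerre_norm p \<alpha> {R..} f" for f
        using R(1) by (intro laguerre_norm_cong) (simp add: borel_rep_eq)
      then show "\<exists>R>0. \<forall>f\<in>S. laguerre_norm p \<alpha> {R..} f \<le> ennreal \<epsilon>"
        using R(1) bspec[OF R(2) c(3)] by (intro exI[of _ R]) (auto simp: S_def less_imp_le)
    next
      fix \<epsilon> M :: real assume \<epsilon>M: "0 < \<epsilon>" "0 < M"
      obtain \<delta> where \<delta>: "0 < \<delta>" "\<forall>t h. 0 \<le> t \<and> t \<le> M \<and> 0 \<le> h \<and> h \<le> \<delta> \<longrightarrow> (\<forall>f\<in>\<Union>K.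
          laguerre_norm p \<alpha> {0..} (\<lambda>x. laguerre_translation \<alpha> (t + h) f x - laguerre_translation \<alpha> t f x) < ennreal \<epsilon>)"
        using equicont[OF \<epsilon>M] by (elim exE conjE)
      have "laguerre_norm p \<alpha> {0..} (\<lambda>x. laguerre_translation \<alpha> (t + h) f x - laguerre_translation \<alpha> t f x) \<le> ennreal \<epsilon>"
        if f: "f \<in> S" and th: "0 \<le> t" "t \<le> M" "0 \<le> h" "h \<le> \<delta>" for f t h
      proof -
        obtain F where F: "F \<in> K" "f = borel_rep (c F)" using S[OF f] by blast
        show ?thesis
          using \<delta>(2)[rule_format, of t h "c F"] th c(3)[OF F(1)]
          by (simp add: F laguerre_norm_translation_diff_borel_rep less_imp_le del: Union_iff)
      qed
      then show "\<exists>\<delta>>0. \<forall>f\<in>S. \<forall>t h. 0 \<le> t \<and> t \<le> M \<and> 0 \<le> h \<and> h \<le> \<delta> \<longrightarrow>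
          laguerre_norm p \<alpha> {0..} (\<lambda>x. laguerre_translation \<alpha> (t + h) f x - laguerre_translation \<alpha> t f x) \<le> ennreal \<epsilon>"
        using \<delta>(1) by blast
    next
      fix f assume "f \<in> S"
      then show "f \<in> borel_measurable borel"
        using S c(2) borel_measurable_borel_rep by blast
    qed (use b(2) e in auto)
    define Q where "Q F = q (borel_rep (c F))" for F
    have "finite (Q ` K)" using q(1) by (simp add: S_def Q_def image_image)
    then have "\<exists>Y\<subseteq>K. finite Y \<and> Q ` K = Q ` Y" by (rule finite_subset_image) (rule order_refl)
    then obtain Y where Y: "Y \<subseteq> K" "finite Y" "Q ` Y = Q ` K" by (elim exE conjE) simp
    have "F \<in> (\<Union>G\<in>Y. mball G e)" if F: "F \<in> K" for F
    proof -
      have "Q F \<in> Q ` Y" using F Y(3) by blast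
      then obtain G where G: "G \<in> Y" "Q G = Q F" by auto
      then have GK: "G \<in> K" using Y(1) by blast
      have "ennreal (laguerre_dist p \<alpha> G F) = laguerre_norm p \<alpha> {0..} (\<lambda>x. c G x - c F x)"
        using GK F by (rule dist[symmetric])
      also have "\<dots> \<le> ennreal (e / 2)"
        using q(2)[of "borel_rep (c G)" "borel_rep (c F)"] F GK G(2)
        by (simp add: S_def Q_def laguerre_norm_borel_rep_diff)
      finally have "laguerre_dist p \<alpha> G F \<le> e / 2" using e by (subst (asm) ennreal_le_iff) auto
      then have "F \<in> mball G e" using e F GK K by (auto simp: in_mball)
      then show ?thesis using G(1) by blast
    qed
    then show "\<exists>Y. finite Y \<and> Y \<subseteq> K \<and> K \<subseteq> (\<Union>G\<in>Y. mball G e)" using Y by blast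
  qed
qed

theorem theorem1:
  fixes p \<alpha> :: real and K :: "(real \<Rightarrow> real) set set"
  assumes "1 \<le> p" and "0 \<le> \<alpha>"
    and "K \<subseteq> laguerre_Lp p \<alpha>"
    and "Metric_space.mbounded (laguerre_Lp p \<alpha>) (laguerre_dist p \<alpha>) K"
  shows "Metric_space.mtotally_bounded (laguerre_Lp p \<alpha>) (laguerre_dist p \<alpha>) K \<longleftrightarrow>
    (\<forall>\<epsilon>>0::real. \<exists>R>0. \<forall>f\<in>\<Union>K. laguerre_norm p \<alpha> {R..} f < ennreal \<epsilon>) \<and>
    (\<forall>\<epsilon>>0::real. \<forall>M0>0. \<exists>\<delta>>0. \<forall>t h. 0 \<le> t \<and> t \<le> M0 \<and> 0 \<le> h \<and> h \<le> \<delta> \<longrightarrow>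
      (\<forall>f\<in>\<Union>K. laguerre_norm p \<alpha> {0..}
          (\<lambda>x. laguerre_translation \<alpha> (t + h) f x - laguerre_translation \<alpha> t f x) < ennreal \<epsilon>))"
    (is "?tb \<longleftrightarrow> ?tails \<and> ?equicont")
proof
  assume ?tb
  show "?tails \<and> ?equicont"
  proof (intro conjI allI impI)
    show "\<exists>R>0. \<forall>f\<in>\<Union>K. laguerre_norm p \<alpha> {R..} f < ennreal \<epsilon>" if "0 < \<epsilon>" for \<epsilon>
      by (rule mtotally_bounded_imp_uniform_tails[OF assms(1,3) \<open>?tb\<close> that])
    show "\<exists>\<delta>>0. \<forall>t h. 0 \<le> t \<and> t \<le> M0 \<and> 0 \<le> h \<and> h \<le> \<delta> \<longrightarrow> (\<forall>f\<in>\<Union>K. laguerre_norm p \<alpha> {0..}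
        (\<lambda>x. laguerre_translation \<alpha> (t + h) f x - laguerre_translation \<alpha> t f x) < ennreal \<epsilon>)"
      if "0 < \<epsilon>" "0 < M0" for \<epsilon> M0
      by (rule mtotally_bounded_imp_equicontinuous_translates[OF assms(1-3) \<open>?tb\<close> that])
  qed
next
  assume PQ: "?tails \<and> ?equicont"
  show ?tb
    by (rule mtotally_bounded_if_tails_and_equicontinuous_translates[OF assms
          mp[OF spec[OF conjunct1[OF PQ]]] mp[OF spec[OF mp[OF spec[OF conjunct2[OF PQ]]]]]])
qed

end
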